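(* Let $T$ be the max-plus quasi-field of reals, and let $P,Q\in T\{X_1,\dots,X_n\}$. Then $V(P)\subset V(Q)$ if and only if $P$ divides some power $Q^k$ ($k\ge1$) in $T\{X_1,\dots,X_n\}$.
   Context: $T$ is $\mathbb R_{\ge0}$ with addition $u+v=\max(u,v)$ and usual multiplication (isomorphic to $\mathbb R\cup\{-\infty\}$ with $\max$ and $+$); it is a totally ordered quasi-field of characteristic $1$. $T\{X_1,\dots,X_n\}$ is the image of $T[X_1,\dots,X_n]$ in its quasi-field of fractions, i.e. the quotient by $P\sim Q$ iff $RP=RQ$ for some nonzero $R$ (rational polynomials). A point $x\in T^n$ is a zero of a polynomial $P$ if $P(x)=0$ or the maximum of the values at $x$ of the monomials of $P$ is attained by at least two distinct monomials; this does not depend on the representative, so it defines zeros of rational polynomials. $V(P)\subset T^n$ is the set of zeros of $P$. $P$ divides $S$ means $S=PR$ for some $R\in T\{X_1,\dots,X_n\}$. *)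

theory Defs
  imports Main "HOL.Real"
begin

text \<open>Tropical (max-times) polynomials in the variables indexed by a finite type 'n,
  with coefficients in T = nonnegative reals. A polynomial is its coefficient function
  on exponent vectors; a tropical polynomial has nonnegative coefficients and finite support.\<close>

type_synonym 'n tpoly = "('n \<Rightarrow> nat) \<Rightarrow> real"

definition is_tpoly :: "'n tpoly \<Rightarrow> bool" where
  "is_tpoly P \<longleftrightarrow> (\<forall>m. P m \<ge> 0) \<and> finite {m. P m \<noteq> 0}"

definition tpoly_zero :: "'n tpoly" where
  "tpoly_zero = (\<lambda>m. 0)"

definition tpoly_one :: "'n tpoly" where
  "tpoly_one = (\<lambda>m. if m = (\<lambda>i. 0) then 1 else 0)"

definition tpoly_mult :: "'n tpoly \<Rightarrow> 'n tpoly \<Rightarrow> 'n tpoly" where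
  "tpoly_mult P Q = (\<lambda>m. Max (insert 0 {P a * Q b | a b. (\<forall>i. a i + b i = m i)}))"

fun tpoly_pow :: "'n tpoly \<Rightarrow> nat \<Rightarrow> 'n tpoly" where
  "tpoly_pow P 0 = tpoly_one"
| "tpoly_pow P (Suc k) = tpoly_mult P (tpoly_pow P k)"

text \<open>Equality in T{X}: P ~ Q iff R P = R Q for some nonzero polynomial R.\<close>
definition tpoly_equiv :: "'n tpoly \<Rightarrow> 'n tpoly \<Rightarrow> bool" where
  "tpoly_equiv P Q \<longleftrightarrow> (\<exists>R. is_tpoly R \<and> R \<noteq> tpoly_zero \<and> tpoly_mult R P = tpoly_mult R Q)"

definition tpoly_dvd :: "'n tpoly \<Rightarrow> 'n tpoly \<Rightarrow> bool" where
  "tpoly_dvd P S \<longleftrightarrow> (\<exists>R. is_tpoly R \<and> tpoly_equiv S (tpoly_mult P R))"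

definition mono_val :: "('n::finite \<Rightarrow> real) \<Rightarrow> ('n \<Rightarrow> nat) \<Rightarrow> real" where
  "mono_val x m = (\<Prod>i\<in>UNIV. x i ^ m i)"

definition is_tzero :: "'n::finite tpoly \<Rightarrow> ('n \<Rightarrow> real) \<Rightarrow> bool" where
  "is_tzero P x \<longleftrightarrow>
     (\<forall>m. P m * mono_val x m = 0) \<or>
     (\<exists>a b. a \<noteq> b \<and> P a \<noteq> 0 \<and> P b \<noteq> 0 \<and> P a * mono_val x a = P b * mono_val x b \<and>
            (\<forall>c. P c * mono_val x c \<le> P a * mono_val x a))"

definition tvar :: "'n::finite tpoly \<Rightarrow> ('n \<Rightarrow> real) set" where
  "tvar P = {x. (\<forall>i. 0 \<le> x i) \<and> is_tzero P x}"

end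

theory Submission
  imports Defs Complex_Main "HOL-Library.FuncSet"
begin

text \<open>In logarithmic coordinates a polynomial is a maximum of finitely many affine functions, and
  two polynomials are equal in \<open>T{X}\<close> iff they define the same function: if a monomial \<open>M\<close> lies below
  \<open>A\<close> everywhere, then an integral Farkas lemma, proved by Fourier--Motzkin elimination, yields
  \<open>M\<^sup>N \<le> A\<^sup>N\<close> coefficientwise, so that \<open>(A + M)\<^sup>N = A (A + M)\<^bsup>N - 1\<^esup>\<close>.

  Suppose \<open>V(P) \<subseteq> V(Q)\<close>. On the cell where a monomial \<open>b\<close> strictly dominates \<open>Q\<close>, a single monomial
  \<open>\<alpha>(b)\<close> dominates \<open>P\<close>, because the cell is connected. For large \<open>k\<close> the quotient
  \<open>R = max b\<^sup>k / \<alpha>(b)\<close> is a polynomial with \<open>P R = Q\<^sup>k\<close>: by Farkas' lemma again, \<open>\<alpha>(b) / \<alpha>(b')\<close> is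
  bounded on the cell of \<open>b\<close> by a power of \<open>b / b'\<close>, and the exponents of \<open>R\<close> are nonnegative because
  the inclusion also holds at points with a zero coordinate. Conversely, a point with a single
  dominating monomial of \<open>Q\<^sup>k = P R\<close> has a single one of \<open>P\<close>.\<close>

section \<open>A theorem of the alternative for strict inequalities\<close>

definition affine_value :: "('i::finite \<Rightarrow> int) \<times> real \<Rightarrow> ('i \<Rightarrow> real) \<Rightarrow> real" where
  "affine_value p y = (\<Sum>i\<in>UNIV. of_int (fst p i) * y i) + snd p"

inductive_set sum_closure :: "(('i \<Rightarrow> int) \<times> real) set \<Rightarrow> (('i \<Rightarrow> int) \<times> real) set" for S where
  base: "p \<in> S \<Longrightarrow> p \<in> sum_closure S"
| add: "(u, c) \<in> sum_closure S \<Longrightarrow> (v, d) \<in> sum_closure S \<Longrightarrow> (\<lambda>i. u i + v i, c + d) \<in> sum_closure S"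

lemma affine_value_add:
  "affine_value (\<lambda>i. u i + v i, c + d) y = affine_value (u, c) y + affine_value (v, d) y"
  by (simp add: affine_value_def distrib_right sum.distrib)

lemma affine_value_scale:
  "affine_value (\<lambda>i. int n * v i, real n * c) y = real n * affine_value (v, c) y"
  by (simp add: affine_value_def distrib_left sum_distrib_left mult.assoc)

lemma affine_value_fun_upd:
  "affine_value p (y(k := t)) = affine_value p y + of_int (fst p k) * (t - y k)"
proof -
  have "(\<Sum>i\<in>UNIV - {k}. of_int (fst p i) * (y(k := t)) i) = (\<Sum>i\<in>UNIV - {k}. of_int (fst p i) * y i)"
    by (rule sum.cong) auto
  then show ?thesis
    by (simp add: affine_value_def sum.remove[of UNIV k] right_diff_distrib)
qed

lemma sum_closure_minimal:
  assumes "S \<subseteq> sum_closure T"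
  shows "sum_closure S \<subseteq> sum_closure T"
proof
  fix p assume "p \<in> sum_closure S"
  then show "p \<in> sum_closure T"
    by induction (use assms in \<open>auto intro: sum_closure.add\<close>)
qed

lemma sum_closure_scale:
  assumes "(v, c) \<in> sum_closure S" "0 < n"
  shows "(\<lambda>i. int n * v i, real n * c) \<in> sum_closure S"
  using assms(2)
proof (induction n rule: nat_induct_non_zero)
  case (Suc n)
  from sum_closure.add[OF assms(1) Suc.IH] show ?case by (simp add: distrib_right)
qed (use assms(1) in simp)

lemma finite_strictly_separated:
  fixes L U :: "'a::unbounded_dense_linorder set"
  assumes "finite L" "finite U" "\<And>l u. l \<in> L \<Longrightarrow> u \<in> U \<Longrightarrow> l < u"
  obtains t where "\<And>l. l \<in> L \<Longrightarrow> l < t" "\<And>u. u \<in> U \<Longrightarrow> t < u"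
proof (cases "L = {} \<or> U = {}")
  case True
  obtain a where "\<forall>l\<in>L. l < a"
    using gt_ex[of "Max L"] assms(1) by (cases "L = {}") auto
  moreover obtain b where "\<forall>u\<in>U. b < u"
    using lt_ex[of "Min U"] assms(2) by (cases "U = {}") auto
  ultimately show ?thesis using True that by blast
next
  case False
  then have "Max L < Min U" using assms by simp
  then obtain t where "Max L < t" "t < Min U" using dense by blast
  with False assms(1,2) show ?thesis by (intro that[of t]) auto
qed

definition cancel_coordinate ::
  "'i \<Rightarrow> ('i \<Rightarrow> int) \<times> real \<Rightarrow> ('i \<Rightarrow> int) \<times> real \<Rightarrow> ('i \<Rightarrow> int) \<times> real" where
  "cancel_coordinate k p q =
     (\<lambda>i. int (nat (- fst q k)) * fst p i + int (nat (fst p k)) * fst q i,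
      real (nat (- fst q k)) * snd p + real (nat (fst p k)) * snd q)"

definition fourier_motzkin_step :: "'i \<Rightarrow> (('i \<Rightarrow> int) \<times> real) set \<Rightarrow> (('i \<Rightarrow> int) \<times> real) set" where
  "fourier_motzkin_step k S = {p \<in> S. fst p k = 0} \<union>
     (\<lambda>(p, q). cancel_coordinate k p q) ` ({p \<in> S. 0 < fst p k} \<times> {q \<in> S. fst q k < 0})"

lemma affine_value_cancel_coordinate:
  assumes "0 < fst p k" "fst q k < 0"
  shows "affine_value (cancel_coordinate k p q) y =
    of_int (- fst q k) * affine_value p y + of_int (fst p k) * affine_value q y"
  using assms unfolding cancel_coordinate_def affine_value_add affine_value_scale by simp

lemma finite_fourier_motzkin_step: "finite S \<Longrightarrow> finite (fourier_motzkin_step k S)"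
  by (simp add: fourier_motzkin_step_def)

lemma fourier_motzkin_step_subset: "fourier_motzkin_step k S \<subseteq> sum_closure S"
proof -
  have "cancel_coordinate k p q \<in> sum_closure S"
    if "p \<in> S" "q \<in> S" "0 < fst p k" "fst q k < 0" for p q
    unfolding cancel_coordinate_def
    using that by (intro sum_closure.add sum_closure_scale) (auto intro: sum_closure.base)
  then show ?thesis by (auto simp: fourier_motzkin_step_def intro: sum_closure.base)
qed

lemma fourier_motzkin_step_eliminates: "p \<in> fourier_motzkin_step k S \<Longrightarrow> fst p k = 0"
  by (auto simp: fourier_motzkin_step_def cancel_coordinate_def)

lemma fourier_motzkin_step_preserves_zero:
  assumes "\<forall>q\<in>S. fst q i = 0" "p \<in> fourier_motzkin_step k S"
  shows "fst p i = 0"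
proof -
  from assms(2) consider "p \<in> S" | q r where "q \<in> S" "r \<in> S" "p = cancel_coordinate k q r"
    by (auto simp: fourier_motzkin_step_def)
  then show ?thesis using assms(1) by cases (auto simp: cancel_coordinate_def)
qed

lemma fourier_motzkin_step_feasible:
  assumes "finite S" and solution: "\<And>p. p \<in> fourier_motzkin_step k S \<Longrightarrow> 0 < affine_value p y"
  shows "\<exists>t. \<forall>p\<in>S. 0 < affine_value p (y(k := t))"
proof -
  let ?bound = "\<lambda>p. - affine_value p y / fst p k"
  let ?Pos = "{p \<in> S. 0 < fst p k}" and ?Neg = "{q \<in> S. fst q k < 0}"
  have "?bound p < ?bound q" if "p \<in> ?Pos" "q \<in> ?Neg" for p q
  proof -
    have "cancel_coordinate k p q \<in> fourier_motzkin_step k S"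
      using that by (auto simp: fourier_motzkin_step_def)
    from solution[OF this]
    have "0 < of_int (- fst q k) * affine_value p y + of_int (fst p k) * affine_value q y"
      using that by (simp add: affine_value_cancel_coordinate)
    then show ?thesis using that by (simp add: field_simps)
  qed
  then have "\<And>l u. l \<in> ?bound ` ?Pos \<Longrightarrow> u \<in> ?bound ` ?Neg \<Longrightarrow> l < u" by blast
  moreover have "finite (?bound ` ?Pos)" "finite (?bound ` ?Neg)" using assms(1) by auto
  ultimately obtain s where separated: "\<And>l. l \<in> ?bound ` ?Pos \<Longrightarrow> l < s"
      "\<And>u. u \<in> ?bound ` ?Neg \<Longrightarrow> s < u"
    using finite_strictly_separated[of "?bound ` ?Pos" "?bound ` ?Neg"] by blast
  have "0 < affine_value p y + of_int (fst p k) * s" if "p \<in> S" for p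
  proof -
    consider (positive) "0 < fst p k" | (negative) "fst p k < 0" | (zero) "fst p k = 0" by linarith
    then show ?thesis
    proof cases
      case positive
      with separated(1)[OF imageI, of p] that show ?thesis by (simp add: field_simps)
    next
      case negative
      with separated(2)[OF imageI, of p] that show ?thesis by (simp add: field_simps)
    next
      case zero
      with solution[of p] that show ?thesis by (simp add: fourier_motzkin_step_def)
    qed
  qed
  then show ?thesis by (intro exI[of _ "y k + s"]) (simp add: affine_value_fun_upd)
qed

lemma strict_farkas_supported:
  assumes "finite I" "finite S" "\<And>p i. p \<in> S \<Longrightarrow> i \<notin> I \<Longrightarrow> fst p i = 0"
    and "\<nexists>y. \<forall>p\<in>S. 0 < affine_value p y"
  shows "\<exists>c\<le>0. (\<lambda>i. 0, c) \<in> sum_closure S"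
  using assms
proof (induction I arbitrary: S rule: finite_induct)
  case empty
  then obtain p where p: "p \<in> S" "affine_value p (\<lambda>i. 0) \<le> 0" by (meson not_le)
  have "fst p = (\<lambda>i. 0)" using empty.prems(2)[OF p(1)] by auto
  then have "(\<lambda>i. 0, snd p) \<in> sum_closure S"
    using sum_closure.base[OF p(1)] by (metis prod.collapse)
  moreover have "snd p \<le> 0" using p(2) by (simp add: affine_value_def)
  ultimately show ?case by blast
next
  case (insert k I)
  let ?S = "fourier_motzkin_step k S"
  have "\<nexists>y. \<forall>p\<in>?S. 0 < affine_value p y"
    using fourier_motzkin_step_feasible insert.prems(1,3) by blast
  moreover have "fst p i = 0" if "p \<in> ?S" "i \<notin> I" for p i
  proof (cases "i = k")
    case True
    with that(1) show ?thesis by (simp add: fourier_motzkin_step_eliminates)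
  next
    case False
    with that insert.prems(2) show ?thesis
      by (intro fourier_motzkin_step_preserves_zero[of S i p k]) auto
  qed
  ultimately have "\<exists>c\<le>0. (\<lambda>i. 0, c) \<in> sum_closure ?S"
    by (intro insert.IH finite_fourier_motzkin_step insert.prems(1)) blast+
  then show ?case using sum_closure_minimal[OF fourier_motzkin_step_subset, of k S] by blast
qed

lemma strict_farkas:
  fixes S :: "(('i::finite \<Rightarrow> int) \<times> real) set"
  assumes "finite S" "\<nexists>y. \<forall>p\<in>S. 0 < affine_value p y"
  obtains c where "c \<le> 0" "(\<lambda>i. 0, c) \<in> sum_closure S"
  using strict_farkas_supported[of UNIV S] assms by auto

lemma sum_closure_insert_lower_bound:
  assumes "p \<in> sum_closure (insert f S)"
    and "\<forall>p\<in>S. 0 < affine_value p w" and "\<forall>y\<in>C. \<forall>p\<in>S. - g y \<le> affine_value p y"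
  shows "\<exists>N K. (\<forall>y\<in>C. real N * affine_value f y - real K * g y \<le> affine_value p y) \<and>
    (N = 0 \<longrightarrow> 0 < affine_value p w)"
  using assms(1)
proof induction
  case (base p)
  then show ?case
  proof
    assume "p = f"
    then show ?thesis by (intro exI[of _ 1] exI[of _ 0]) simp
  next
    assume "p \<in> S"
    then show ?thesis using assms(2,3) by (intro exI[of _ 0] exI[of _ 1]) simp
  qed
next
  case (add u c v d)
  then obtain N K M L where
    "\<forall>y\<in>C. real N * affine_value f y - real K * g y \<le> affine_value (u, c) y"
    "\<forall>y\<in>C. real M * affine_value f y - real L * g y \<le> affine_value (v, d) y"
    "N = 0 \<longrightarrow> 0 < affine_value (u, c) w" "M = 0 \<longrightarrow> 0 < affine_value (v, d) w"
    by blast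
  then show ?case
    unfolding affine_value_add
    by (intro exI[of _ "N + M"] exI[of _ "K + L"]) (fastforce simp: distrib_right)
qed

lemma strict_farkas_bound:
  fixes S :: "(('i::finite \<Rightarrow> int) \<times> real) set"
  assumes "finite S" and feasible: "\<forall>p\<in>S. 0 < affine_value p w"
    and implied: "\<And>y. \<forall>p\<in>S. 0 < affine_value p y \<Longrightarrow> affine_value f y \<le> 0"
    and g_nonneg: "\<forall>y\<in>C. 0 \<le> g y" and g_bound: "\<forall>y\<in>C. \<forall>p\<in>S. - g y \<le> affine_value p y"
  shows "\<exists>K::nat. \<forall>y\<in>C. affine_value f y \<le> real K * g y"
proof -
  have "\<nexists>y. \<forall>p\<in>insert f S. 0 < affine_value p y" using implied by force
  then obtain c where "c \<le> 0" "(\<lambda>i. 0, c) \<in> sum_closure (insert f S)"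
    using strict_farkas[of "insert f S"] assms(1) by auto
  from sum_closure_insert_lower_bound[OF this(2) feasible g_bound]
  obtain N K where bound: "\<forall>y\<in>C. real N * affine_value f y - real K * g y \<le> c" and "N = 0 \<longrightarrow> 0 < c"
    by (auto simp: affine_value_def)
  with \<open>c \<le> 0\<close> have "N \<noteq> 0" by linarith
  have "affine_value f y \<le> real K * g y" if y: "y \<in> C" for y
  proof (cases "affine_value f y \<le> 0")
    case True
    also have "0 \<le> real K * g y" using g_nonneg y by simp
    finally show ?thesis .
  next
    case False
    then have "1 * affine_value f y \<le> real N * affine_value f y"
      using \<open>N \<noteq> 0\<close> by (intro mult_right_mono) auto
    with bound y \<open>c \<le> 0\<close> show ?thesis by force
  qed
  then show ?thesis by blast
qed

section \<open>The semiring of tropical polynomials\<close>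

lemma is_tpoly_nonneg: "is_tpoly P \<Longrightarrow> 0 \<le> P m"
  by (simp add: is_tpoly_def)

lemma is_tpoly_finite: "is_tpoly P \<Longrightarrow> finite {m. P m \<noteq> 0}"
  by (simp add: is_tpoly_def)

lemma is_tpoly_pos: "is_tpoly P \<Longrightarrow> P m \<noteq> 0 \<Longrightarrow> 0 < P m"
  by (metis is_tpoly_nonneg order_le_less)

lemma is_tpoly_zero: "is_tpoly tpoly_zero"
  by (simp add: is_tpoly_def tpoly_zero_def)

lemma is_tpoly_one: "is_tpoly tpoly_one"
  by (simp add: is_tpoly_def tpoly_one_def)

lemma is_tpoly_sup:
  assumes "is_tpoly P" "is_tpoly Q"
  shows "is_tpoly (sup P Q)"
proof -
  have "{m. sup P Q m \<noteq> 0} \<subseteq> {m. P m \<noteq> 0} \<union> {m. Q m \<noteq> 0}" by (auto simp: sup_max max_def)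
  then have "finite {m. sup P Q m \<noteq> 0}"
    by (rule finite_subset) (use assms in \<open>simp add: is_tpoly_finite\<close>)
  then show ?thesis using assms by (simp add: is_tpoly_def le_supI1)
qed

lemma tpoly_nonzero_iff: "P \<noteq> tpoly_zero \<longleftrightarrow> (\<exists>m. P m \<noteq> 0)"
  by (auto simp: tpoly_zero_def)

lemma tpoly_one_nonzero: "tpoly_one \<noteq> tpoly_zero"
  by (auto simp: tpoly_nonzero_iff tpoly_one_def)

lemma finite_tpoly_mult_terms:
  fixes m :: "'n::finite \<Rightarrow> nat"
  shows "finite {P a * Q b | a b. (\<forall>i. a i + b i = m i)}"
proof (rule finite_surj)
  show "finite (PiE UNIV (\<lambda>i. {..m i}))" by (rule finite_PiE) auto
  show "{P a * Q b | a b. (\<forall>i. a i + b i = m i)} \<subseteq>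
      (\<lambda>a. P a * Q (\<lambda>i. m i - a i)) ` PiE UNIV (\<lambda>i. {..m i})"
  proof safe
    fix a b assume "\<forall>i. a i + b i = m i"
    then have m: "m i = a i + b i" for i by simp
    show "P a * Q b \<in> (\<lambda>a. P a * Q (\<lambda>i. m i - a i)) ` PiE UNIV (\<lambda>i. {..m i})"
      by (rule image_eqI[of _ _ a]) (simp_all add: m PiE_UNIV_domain)
  qed
qed

lemma tpoly_mult_nonneg: "0 \<le> tpoly_mult P Q (m :: 'n::finite \<Rightarrow> nat)"
  unfolding tpoly_mult_def using finite_tpoly_mult_terms[of P Q m] by (intro Max_ge) auto

lemma tpoly_mult_ge: "P a * Q b \<le> tpoly_mult P Q (\<lambda>i::'n::finite. a i + b i)"
  unfolding tpoly_mult_def using finite_tpoly_mult_terms[of P Q "\<lambda>i. a i + b i"]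
  by (intro Max_ge) auto

lemma tpoly_mult_cases:
  fixes m :: "'n::finite \<Rightarrow> nat"
  obtains (zero) "tpoly_mult P Q m = 0"
  | (product) a b where "m = (\<lambda>i. a i + b i)" "tpoly_mult P Q m = P a * Q b"
proof -
  have "tpoly_mult P Q m \<in> insert 0 {P a * Q b | a b. (\<forall>i. a i + b i = m i)}"
    unfolding tpoly_mult_def using finite_tpoly_mult_terms[of P Q m] by (intro Max_in) auto
  then show ?thesis using that by (auto simp flip: fun_eq_iff)
qed

lemma tpoly_mult_leI:
  fixes P Q :: "'n::finite tpoly"
  assumes "\<And>m. 0 \<le> R m" "\<And>a b. P a * Q b \<le> R (\<lambda>i. a i + b i)"
  shows "tpoly_mult P Q \<le> R"
proof (rule le_funI)
  fix m show "tpoly_mult P Q m \<le> R m"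
    by (cases rule: tpoly_mult_cases[of P Q m]) (use assms in auto)
qed

lemma is_tpoly_mult:
  fixes P Q :: "'n::finite tpoly"
  assumes "is_tpoly P" "is_tpoly Q"
  shows "is_tpoly (tpoly_mult P Q)"
proof -
  have "{m. tpoly_mult P Q m \<noteq> 0} \<subseteq> (\<lambda>(a, b) i. a i + b i) ` ({m. P m \<noteq> 0} \<times> {m. Q m \<noteq> 0})"
  proof
    fix m assume "m \<in> {m. tpoly_mult P Q m \<noteq> 0}"
    then show "m \<in> (\<lambda>(a, b) i. a i + b i) ` ({m. P m \<noteq> 0} \<times> {m. Q m \<noteq> 0})"
      by (cases rule: tpoly_mult_cases[of P Q m]) force+
  qed
  then have "finite {m. tpoly_mult P Q m \<noteq> 0}"
    by (rule finite_subset) (use assms in \<open>auto simp: is_tpoly_finite\<close>)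
  then show ?thesis by (simp add: is_tpoly_def tpoly_mult_nonneg)
qed

lemma is_tpoly_pow: "is_tpoly P \<Longrightarrow> is_tpoly (tpoly_pow P k :: 'n::finite tpoly)"
  by (induction k) (auto simp: is_tpoly_one is_tpoly_mult)

lemma tpoly_mult_commute: "tpoly_mult P Q = tpoly_mult Q P"
proof
  fix m
  have "{P a * Q b | a b. (\<forall>i. a i + b i = m i)} = {Q a * P b | a b. (\<forall>i. a i + b i = m i)}"
    by (metis (no_types, lifting) add.commute mult.commute)
  then show "tpoly_mult P Q m = tpoly_mult Q P m" by (simp add: tpoly_mult_def)
qed

lemma tpoly_mult_mono:
  fixes P Q :: "'n::finite tpoly"
  assumes "is_tpoly P" "is_tpoly Q" "P \<le> P'" "Q \<le> Q'"
  shows "tpoly_mult P Q \<le> tpoly_mult P' Q'"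
proof (rule tpoly_mult_leI[OF tpoly_mult_nonneg])
  fix a b
  have "P a * Q b \<le> P' a * Q' b"
    using assms
    by (intro mult_mono)
      (auto simp: le_fun_def is_tpoly_nonneg intro: order_trans[OF is_tpoly_nonneg])
  then show "P a * Q b \<le> tpoly_mult P' Q' (\<lambda>i. a i + b i)"
    using tpoly_mult_ge by (rule order_trans)
qed

lemma tpoly_mult_sup_right:
  fixes P Q R :: "'n::finite tpoly"
  assumes "is_tpoly P" "is_tpoly Q" "is_tpoly R"
  shows "tpoly_mult P (sup Q R) = sup (tpoly_mult P Q) (tpoly_mult P R)"
proof (rule order_antisym)
  show "tpoly_mult P (sup Q R) \<le> sup (tpoly_mult P Q) (tpoly_mult P R)"
  proof (rule tpoly_mult_leI)
    show "P a * sup Q R b \<le> sup (tpoly_mult P Q) (tpoly_mult P R) (\<lambda>i. a i + b i)" for a b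
      using tpoly_mult_ge[of P a Q b] tpoly_mult_ge[of P a R b] by (auto simp: sup_max max_def)
  qed (simp add: le_supI1 tpoly_mult_nonneg)
  show "sup (tpoly_mult P Q) (tpoly_mult P R) \<le> tpoly_mult P (sup Q R)"
    using assms by (intro sup_least tpoly_mult_mono) auto
qed

lemma tpoly_mult_assoc_le:
  fixes P Q R :: "'n::finite tpoly"
  assumes "is_tpoly P" "is_tpoly Q" "is_tpoly R"
  shows "tpoly_mult (tpoly_mult P Q) R \<le> tpoly_mult P (tpoly_mult Q R)"
proof (rule tpoly_mult_leI[OF tpoly_mult_nonneg])
  fix u c
  show "tpoly_mult P Q u * R c \<le> tpoly_mult P (tpoly_mult Q R) (\<lambda>i. u i + c i)"
  proof (cases rule: tpoly_mult_cases[of P Q u])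
    case zero
    then show ?thesis by (simp add: tpoly_mult_nonneg)
  next
    case (product a b)
    have "tpoly_mult P Q u * R c = P a * (Q b * R c)" by (simp add: product(2))
    also have "\<dots> \<le> P a * tpoly_mult Q R (\<lambda>i. b i + c i)"
      by (rule mult_left_mono[OF tpoly_mult_ge is_tpoly_nonneg[OF assms(1)]])
    also have "\<dots> \<le> tpoly_mult P (tpoly_mult Q R) (\<lambda>i. a i + (b i + c i))"
      by (rule tpoly_mult_ge)
    finally show ?thesis by (simp add: product(1) add.assoc)
  qed
qed

lemma tpoly_mult_assoc:
  fixes P Q R :: "'n::finite tpoly"
  assumes "is_tpoly P" "is_tpoly Q" "is_tpoly R"
  shows "tpoly_mult (tpoly_mult P Q) R = tpoly_mult P (tpoly_mult Q R)"
proof (rule order_antisym)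
  show "tpoly_mult P (tpoly_mult Q R) \<le> tpoly_mult (tpoly_mult P Q) R"
    using tpoly_mult_assoc_le[OF assms(3,2,1)] by (metis tpoly_mult_commute)
qed (rule tpoly_mult_assoc_le[OF assms])

lemma tpoly_mult_left_commute:
  fixes P Q R :: "'n::finite tpoly"
  assumes "is_tpoly P" "is_tpoly Q" "is_tpoly R"
  shows "tpoly_mult P (tpoly_mult Q R) = tpoly_mult Q (tpoly_mult P R)"
  by (metis assms tpoly_mult_assoc tpoly_mult_commute)

lemma tpoly_mult_one:
  fixes P :: "'n::finite tpoly"
  assumes "is_tpoly P"
  shows "tpoly_mult tpoly_one P = P"
proof (rule order_antisym)
  show "tpoly_mult tpoly_one P \<le> P"
    by (rule tpoly_mult_leI) (use assms in \<open>auto simp: tpoly_one_def is_tpoly_nonneg\<close>)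
  show "P \<le> tpoly_mult tpoly_one P"
    using tpoly_mult_ge[of tpoly_one "\<lambda>i. 0" P] by (simp add: tpoly_one_def le_fun_def)
qed

lemma tpoly_mult_zero: "tpoly_mult P tpoly_zero = (tpoly_zero :: 'n::finite tpoly)"
proof
  fix m show "tpoly_mult P tpoly_zero m = (tpoly_zero m :: real)"
    by (cases rule: tpoly_mult_cases[of P tpoly_zero m]) (auto simp: tpoly_zero_def)
qed

lemma tpoly_mult_nonzero:
  fixes P Q :: "'n::finite tpoly"
  assumes "is_tpoly P" "is_tpoly Q" "P \<noteq> tpoly_zero" "Q \<noteq> tpoly_zero"
  shows "tpoly_mult P Q \<noteq> tpoly_zero"
proof -
  from assms(3,4) obtain a b where "P a \<noteq> 0" "Q b \<noteq> 0" by (auto simp: tpoly_nonzero_iff)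
  then have "0 < P a * Q b" using assms by (simp add: is_tpoly_pos)
  also have "\<dots> \<le> tpoly_mult P Q (\<lambda>i. a i + b i)" by (rule tpoly_mult_ge)
  finally show ?thesis by (metis less_irrefl tpoly_zero_def)
qed

lemma tpoly_pow_nonzero:
  "is_tpoly P \<Longrightarrow> P \<noteq> tpoly_zero \<Longrightarrow> tpoly_pow P k \<noteq> (tpoly_zero :: 'n::finite tpoly)"
  by (induction k) (auto simp: tpoly_one_nonzero tpoly_mult_nonzero is_tpoly_pow)

lemma tpoly_pow_one: "is_tpoly P \<Longrightarrow> tpoly_pow P 1 = (P :: 'n::finite tpoly)"
  using tpoly_mult_one by (simp add: tpoly_mult_commute[of P])

lemma tpoly_pow_mono:
  fixes P Q :: "'n::finite tpoly"
  shows "is_tpoly P \<Longrightarrow> P \<le> Q \<Longrightarrow> tpoly_pow P k \<le> tpoly_pow Q k"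
  by (induction k) (simp_all add: tpoly_mult_mono is_tpoly_pow)

lemma tpoly_pow_add:
  fixes P :: "'n::finite tpoly"
  assumes "is_tpoly P"
  shows "tpoly_pow P (k + l) = tpoly_mult (tpoly_pow P k) (tpoly_pow P l)"
  by (induction k) (use assms in \<open>simp_all add: tpoly_mult_one tpoly_mult_assoc is_tpoly_pow\<close>)

lemma tpoly_pow_sup_le:
  fixes P Q :: "'n::finite tpoly"
  assumes P: "is_tpoly P" and Q: "is_tpoly Q"
  shows "tpoly_pow (sup P Q) (Suc n) \<le>
    sup (tpoly_mult P (tpoly_pow (sup P Q) n)) (tpoly_pow Q (Suc n))"
proof (induction n)
  case 0
  show ?case using P Q by (metis One_nat_def is_tpoly_sup order_refl tpoly_pow.simps tpoly_pow_one)
next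
  case (Suc n)
  define S where "S = sup P Q"
  have S: "is_tpoly S" using P Q by (simp add: S_def is_tpoly_sup)
  note tpolys = P Q S is_tpoly_pow is_tpoly_mult is_tpoly_sup
  let ?rhs = "sup (tpoly_mult P (tpoly_pow S (Suc n))) (tpoly_pow Q (Suc (Suc n)))"
  have "tpoly_mult Q (tpoly_pow S (Suc n)) \<le>
      tpoly_mult Q (sup (tpoly_mult P (tpoly_pow S n)) (tpoly_pow Q (Suc n)))"
    by (rule tpoly_mult_mono[OF Q is_tpoly_pow[OF S] order_refl Suc.IH[folded S_def]])
  also have "\<dots> = sup (tpoly_mult P (tpoly_mult Q (tpoly_pow S n))) (tpoly_pow Q (Suc (Suc n)))"
    by (simp add: tpoly_mult_sup_right tpoly_mult_left_commute[of Q P] tpolys)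
  also have "\<dots> \<le> ?rhs"
    unfolding tpoly_pow.simps(2)[of S]
    by (intro sup_mono order_refl tpoly_mult_mono tpolys) (simp add: S_def)
  finally have "tpoly_mult Q (tpoly_pow S (Suc n)) \<le> ?rhs" .
  then have "sup (tpoly_mult P (tpoly_pow S (Suc n))) (tpoly_mult Q (tpoly_pow S (Suc n))) \<le> ?rhs"
    by simp
  moreover have "tpoly_pow S (Suc (Suc n)) =
      sup (tpoly_mult P (tpoly_pow S (Suc n))) (tpoly_mult Q (tpoly_pow S (Suc n)))"
    using tpoly_mult_sup_right[OF is_tpoly_pow[OF S] P Q, of "Suc n"]
    by (simp add: tpoly_mult_commute S_def)
  ultimately show ?case by (simp only: S_def)
qed

definition tpoly_monom :: "real \<Rightarrow> ('n \<Rightarrow> nat) \<Rightarrow> 'n tpoly" where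
  "tpoly_monom c m = tpoly_zero(m := c)"

lemma is_tpoly_monom: "0 \<le> c \<Longrightarrow> is_tpoly (tpoly_monom c m)"
  by (simp add: is_tpoly_def tpoly_monom_def tpoly_zero_def)

lemma tpoly_monom_le_iff:
  assumes "is_tpoly P"
  shows "tpoly_monom c m \<le> P \<longleftrightarrow> c \<le> P m"
  using assms by (auto simp: le_fun_def tpoly_monom_def tpoly_zero_def is_tpoly_nonneg)

lemma tpoly_pow_monom_le:
  fixes m :: "'n::finite \<Rightarrow> nat"
  assumes "0 \<le> c"
  shows "tpoly_pow (tpoly_monom c m) k \<le> tpoly_monom (c ^ k) (\<lambda>i. k * m i)"
proof (induction k)
  case 0
  show ?case by (auto simp: le_fun_def tpoly_one_def tpoly_monom_def tpoly_zero_def)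
next
  case (Suc k)
  let ?M = "\<lambda>k. tpoly_monom (c ^ k) (\<lambda>i. k * m i)"
  have "tpoly_pow (tpoly_monom c m) (Suc k) \<le> tpoly_mult (tpoly_monom c m) (?M k)"
    unfolding tpoly_pow.simps using Suc assms
    by (intro tpoly_mult_mono is_tpoly_monom is_tpoly_pow) auto
  also have "\<dots> \<le> ?M (Suc k)"
    by (rule tpoly_mult_leI) (use assms in \<open>auto simp: tpoly_monom_def tpoly_zero_def fun_eq_iff\<close>)
  finally show ?case .
qed

text \<open>The order of the quotient semiring \<open>T{X}\<close>.\<close>

definition rational_le :: "'n tpoly \<Rightarrow> 'n tpoly \<Rightarrow> bool" where
  "rational_le P Q \<longleftrightarrow> (\<exists>W. is_tpoly W \<and> W \<noteq> tpoly_zero \<and> tpoly_mult W P \<le> tpoly_mult W Q)"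

lemma tpoly_equiv_refl: "tpoly_equiv P P"
  unfolding tpoly_equiv_def using is_tpoly_one tpoly_one_nonzero by blast

lemma rational_le_common_multiplier:
  fixes P Q :: "'n::finite tpoly"
  assumes tpolys: "is_tpoly P" "is_tpoly P'" "is_tpoly Q" "is_tpoly Q'"
    and "rational_le P P'" "rational_le Q Q'"
  obtains W where "is_tpoly W" "W \<noteq> tpoly_zero"
    "tpoly_mult W P \<le> tpoly_mult W P'" "tpoly_mult W Q \<le> tpoly_mult W Q'"
proof -
  from assms(5,6) obtain U V
    where U: "is_tpoly U" "U \<noteq> tpoly_zero" "tpoly_mult U P \<le> tpoly_mult U P'"
    and V: "is_tpoly V" "V \<noteq> tpoly_zero" "tpoly_mult V Q \<le> tpoly_mult V Q'"
    by (auto simp: rational_le_def)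
  show ?thesis
  proof
    show "is_tpoly (tpoly_mult U V)" "tpoly_mult U V \<noteq> tpoly_zero"
      using U V by (simp_all add: is_tpoly_mult tpoly_mult_nonzero)
    have "tpoly_mult V (tpoly_mult U P) \<le> tpoly_mult V (tpoly_mult U P')"
      using U V tpolys by (simp add: tpoly_mult_mono is_tpoly_mult)
    then show "tpoly_mult (tpoly_mult U V) P \<le> tpoly_mult (tpoly_mult U V) P'"
      using U(1) V(1) tpolys by (simp add: tpoly_mult_assoc tpoly_mult_left_commute[of U V])
    have "tpoly_mult U (tpoly_mult V Q) \<le> tpoly_mult U (tpoly_mult V Q')"
      using U V tpolys by (simp add: tpoly_mult_mono is_tpoly_mult)
    then show "tpoly_mult (tpoly_mult U V) Q \<le> tpoly_mult (tpoly_mult U V) Q'"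
      using U(1) V(1) tpolys by (simp add: tpoly_mult_assoc)
  qed
qed

lemma tpoly_equiv_if_rational_le:
  fixes P Q :: "'n::finite tpoly"
  assumes "is_tpoly P" "is_tpoly Q" "rational_le P Q" "rational_le Q P"
  shows "tpoly_equiv P Q"
  using rational_le_common_multiplier[OF assms(1,2,2,1,3,4)]
  by (metis order_antisym tpoly_equiv_def)

lemma rational_le_sup:
  fixes P Q R :: "'n::finite tpoly"
  assumes tpolys: "is_tpoly P" "is_tpoly Q" "is_tpoly R" and "rational_le P R" "rational_le Q R"
  shows "rational_le (sup P Q) R"
proof -
  obtain W where W: "is_tpoly W" "W \<noteq> tpoly_zero"
    "tpoly_mult W P \<le> tpoly_mult W R" "tpoly_mult W Q \<le> tpoly_mult W R"
    using rational_le_common_multiplier[OF tpolys(1,3,2,3) assms(4,5)] .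
  then have "tpoly_mult W (sup P Q) \<le> tpoly_mult W R" by (simp add: tpoly_mult_sup_right tpolys)
  with W(1,2) show ?thesis by (auto simp: rational_le_def)
qed

lemma rational_le_if_monom_le:
  fixes P Q :: "'n::finite tpoly"
  assumes P: "is_tpoly P" and Q: "is_tpoly Q"
    and monom: "\<And>m. P m \<noteq> 0 \<Longrightarrow> rational_le (tpoly_monom (P m) m) Q"
  shows "rational_le P Q"
proof -
  define restr where "restr F m = (if m \<in> F then P m else 0)" for F m
  have "is_tpoly (restr F) \<and> rational_le (restr F) Q" if "finite F" "F \<subseteq> {m. P m \<noteq> 0}" for F
    using that
  proof (induction F rule: finite_induct)
    case empty
    have "restr {} = tpoly_zero" by (simp add: restr_def tpoly_zero_def fun_eq_iff)
    moreover have "tpoly_zero \<le> Q" using Q by (simp add: tpoly_zero_def le_fun_def is_tpoly_nonneg)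
    then have "tpoly_mult tpoly_one tpoly_zero \<le> tpoly_mult tpoly_one Q"
      using Q by (simp add: tpoly_mult_zero tpoly_mult_one)
    ultimately show ?case
      using is_tpoly_zero is_tpoly_one tpoly_one_nonzero by (auto simp: rational_le_def)
  next
    case (insert m F)
    have "restr (insert m F) = sup (restr F) (tpoly_monom (P m) m)"
      using insert.hyps P
      by (auto simp: restr_def tpoly_monom_def tpoly_zero_def is_tpoly_nonneg
          sup_absorb1 sup_absorb2)
    moreover have "is_tpoly (restr F)" "rational_le (restr F) Q" using insert by auto
    moreover have "is_tpoly (tpoly_monom (P m) m)" "rational_le (tpoly_monom (P m) m) Q"
      using insert.prems is_tpoly_monom[OF is_tpoly_nonneg[OF P]] monom by auto
    ultimately show ?case using rational_le_sup is_tpoly_sup Q by metis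
  qed
  from this[OF is_tpoly_finite[OF P]] have "rational_le (restr {m. P m \<noteq> 0}) Q" by simp
  moreover have "restr {m. P m \<noteq> 0} = P" by (auto simp: restr_def)
  ultimately show ?thesis by simp
qed

text \<open>Every term of the expansion of \<open>(P + Q)\<^sup>n\<close> other than \<open>P\<^sup>n\<close> has a factor \<open>Q\<close>, so that
  \<open>W = (P + Q)\<^bsup>n - 1\<^esup>\<close> satisfies \<open>W P \<le> W Q\<close>.\<close>

lemma rational_le_if_pow_le:
  fixes P Q :: "'n::finite tpoly"
  assumes P: "is_tpoly P" "P \<noteq> tpoly_zero" and Q: "is_tpoly Q"
    and "0 < n" and pow_le: "tpoly_pow P n \<le> tpoly_pow Q n"
  shows "rational_le P Q"
proof -
  from \<open>0 < n\<close> obtain l where n_Suc: "n = Suc l" using gr0_implies_Suc by blast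
  let ?S = "sup Q P"
  have S: "is_tpoly ?S" using P Q by (simp add: is_tpoly_sup)
  have nonzero: "?S \<noteq> tpoly_zero"
  proof -
    from P(2) obtain m where "P m \<noteq> 0" by (auto simp: tpoly_nonzero_iff)
    then have "0 < sup Q P m" using is_tpoly_pos[OF P(1)] by (simp add: sup_max less_max_iff_disj)
    then show ?thesis by (metis less_irrefl tpoly_zero_def)
  qed
  have "tpoly_mult P (tpoly_pow ?S l) \<le> tpoly_pow ?S (Suc l)"
    using P S by (simp add: tpoly_mult_mono is_tpoly_pow)
  also have "\<dots> \<le> sup (tpoly_mult Q (tpoly_pow ?S l)) (tpoly_pow P (Suc l))"
    by (rule tpoly_pow_sup_le[OF Q P(1)])
  also have "\<dots> \<le> tpoly_mult Q (tpoly_pow ?S l)"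
  proof (rule sup_least[OF order_refl])
    have "tpoly_pow P (Suc l) \<le> tpoly_pow Q (Suc l)" using pow_le by (simp only: n_Suc)
    also have "tpoly_pow Q (Suc l) \<le> tpoly_mult Q (tpoly_pow ?S l)"
      using Q S by (simp add: tpoly_mult_mono tpoly_pow_mono is_tpoly_pow)
    finally show "tpoly_pow P (Suc l) \<le> tpoly_mult Q (tpoly_pow ?S l)" .
  qed
  finally have "tpoly_mult (tpoly_pow ?S l) P \<le> tpoly_mult (tpoly_pow ?S l) Q"
    by (simp add: tpoly_mult_commute)
  then show ?thesis
    using is_tpoly_pow[OF S] tpoly_pow_nonzero[OF S nonzero] unfolding rational_le_def by blast
qed

section \<open>Polynomial functions\<close>

definition tpoly_eval :: "'n::finite tpoly \<Rightarrow> ('n \<Rightarrow> real) \<Rightarrow> real" where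
  "tpoly_eval P x = Max (insert 0 ((\<lambda>m. P m * mono_val x m) ` {m. P m \<noteq> 0}))"

lemma mono_val_nonneg: "\<forall>i. 0 \<le> x i \<Longrightarrow> 0 \<le> mono_val x m"
  by (simp add: mono_val_def prod_nonneg)

lemma mono_val_add: "mono_val x (\<lambda>i. a i + b i) = mono_val x a * mono_val x b"
  by (simp add: mono_val_def power_add prod.distrib)

lemma tpoly_term_nonneg: "is_tpoly P \<Longrightarrow> \<forall>i. 0 \<le> x i \<Longrightarrow> 0 \<le> P m * mono_val x m"
  by (simp add: is_tpoly_nonneg mono_val_nonneg)

lemma tpoly_eval_nonneg: "is_tpoly P \<Longrightarrow> 0 \<le> tpoly_eval P x"
  by (simp add: tpoly_eval_def is_tpoly_finite)

lemma tpoly_eval_ge: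
  assumes "is_tpoly P"
  shows "P m * mono_val x m \<le> tpoly_eval P x"
proof (cases "P m = 0")
  case True
  then show ?thesis using tpoly_eval_nonneg[OF assms] by simp
next
  case False
  then show ?thesis using is_tpoly_finite[OF assms] by (auto simp: tpoly_eval_def intro!: Max_ge)
qed

lemma tpoly_eval_attained:
  assumes "is_tpoly P"
  obtains (zero) "tpoly_eval P x = 0" | (monomial) m where "tpoly_eval P x = P m * mono_val x m"
proof -
  have "tpoly_eval P x \<in> insert 0 ((\<lambda>m. P m * mono_val x m) ` {m. P m \<noteq> 0})"
    unfolding tpoly_eval_def using is_tpoly_finite[OF assms] by (intro Max_in) auto
  with that show ?thesis by blast
qed

lemma maximal_monomial_exists:
  assumes "is_tpoly P" "tpoly_eval P x \<noteq> 0"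
  shows "\<exists>m. P m * mono_val x m = tpoly_eval P x"
  using tpoly_eval_attained[OF assms(1), of x] assms(2) by metis

lemma tpoly_eval_leI:
  assumes "is_tpoly P" "0 \<le> c" "\<And>m. P m \<noteq> 0 \<Longrightarrow> P m * mono_val x m \<le> c"
  shows "tpoly_eval P x \<le> c"
  using assms is_tpoly_finite[OF assms(1)] by (auto simp: tpoly_eval_def)

lemma tpoly_eval_lessI:
  assumes "is_tpoly P" "0 < c" "\<And>m. P m \<noteq> 0 \<Longrightarrow> P m * mono_val x m < c"
  shows "tpoly_eval P x < c"
  using assms is_tpoly_finite[OF assms(1)] by (auto simp: tpoly_eval_def)

lemma tpoly_eval_pos:
  assumes "is_tpoly P" "P \<noteq> tpoly_zero" "\<forall>i. 0 < x i"
  shows "0 < tpoly_eval P x"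
proof -
  from assms(2) obtain m where "P m \<noteq> 0" by (auto simp: tpoly_nonzero_iff)
  then have "0 < P m * mono_val x m"
    using assms(1,3) by (simp add: is_tpoly_pos mono_val_def prod_pos)
  also have "\<dots> \<le> tpoly_eval P x" by (rule tpoly_eval_ge[OF assms(1)])
  finally show ?thesis .
qed

lemma tpoly_eval_one: "tpoly_eval tpoly_one x = 1"
proof -
  have "{m. tpoly_one m \<noteq> 0} = {\<lambda>i. 0}" by (auto simp: tpoly_one_def)
  then show ?thesis by (simp add: tpoly_eval_def) (simp add: tpoly_one_def mono_val_def)
qed

lemma tpoly_mult_term_ge:
  assumes "\<forall>i. 0 \<le> x i"
  shows "(P a * mono_val x a) * (Q b * mono_val x b) \<le>
    tpoly_mult P Q (\<lambda>i. a i + b i) * mono_val x (\<lambda>i. a i + b i)"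
proof -
  have "P a * Q b * mono_val x (\<lambda>i. a i + b i) \<le>
      tpoly_mult P Q (\<lambda>i. a i + b i) * mono_val x (\<lambda>i. a i + b i)"
    by (rule mult_right_mono[OF tpoly_mult_ge mono_val_nonneg[OF assms]])
  then show ?thesis by (simp add: mono_val_add mult_ac)
qed

lemma tpoly_eval_mult:
  assumes P: "is_tpoly P" and Q: "is_tpoly Q" and nonneg: "\<forall>i. 0 \<le> x i"
  shows "tpoly_eval (tpoly_mult P Q) x = tpoly_eval P x * tpoly_eval Q x"
proof (rule order_antisym)
  have PQ: "is_tpoly (tpoly_mult P Q)" using P Q by (rule is_tpoly_mult)
  show "tpoly_eval (tpoly_mult P Q) x \<le> tpoly_eval P x * tpoly_eval Q x"
  proof (rule tpoly_eval_leI[OF PQ])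
    fix m assume "tpoly_mult P Q m \<noteq> 0"
    then obtain a b where "m = (\<lambda>i. a i + b i)" "tpoly_mult P Q m = P a * Q b"
      by (cases rule: tpoly_mult_cases[of P Q m]) auto
    then have "tpoly_mult P Q m * mono_val x m = (P a * mono_val x a) * (Q b * mono_val x b)"
      by (simp add: mono_val_add mult_ac)
    also have "\<dots> \<le> tpoly_eval P x * tpoly_eval Q x"
      using P Q nonneg by (intro mult_mono tpoly_eval_ge tpoly_eval_nonneg tpoly_term_nonneg)
    finally show "tpoly_mult P Q m * mono_val x m \<le> tpoly_eval P x * tpoly_eval Q x" .
  qed (simp add: P Q tpoly_eval_nonneg)
  consider (zero) "tpoly_eval P x * tpoly_eval Q x = 0"
    | (monomials) a b where "tpoly_eval P x = P a * mono_val x a"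
        "tpoly_eval Q x = Q b * mono_val x b"
    using tpoly_eval_attained[OF P, of x] tpoly_eval_attained[OF Q, of x] mult_eq_0_iff by metis
  then show "tpoly_eval P x * tpoly_eval Q x \<le> tpoly_eval (tpoly_mult P Q) x"
  proof cases
    case zero
    show ?thesis unfolding zero by (rule tpoly_eval_nonneg[OF PQ])
  next
    case monomials
    then show ?thesis
      using order_trans[OF tpoly_mult_term_ge[OF nonneg] tpoly_eval_ge[OF PQ]] by simp
  qed
qed

lemma tpoly_eval_pow:
  assumes "is_tpoly P" "\<forall>i. 0 \<le> x i"
  shows "tpoly_eval (tpoly_pow P k) x = tpoly_eval P x ^ k"
  by (induction k) (auto simp: tpoly_eval_one tpoly_eval_mult assms is_tpoly_pow)

lemma tendsto_mono_val: "(\<And>i. ((\<lambda>t. X t i) \<longlongrightarrow> x i) F) \<Longrightarrow> ((\<lambda>t. mono_val (X t) m) \<longlongrightarrow> mono_val x m) F"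
  unfolding mono_val_def by (intro tendsto_intros)

lemma tendsto_tpoly_eval:
  assumes P: "is_tpoly P" and lim_X: "\<And>i. ((\<lambda>t. X t i) \<longlongrightarrow> x i) F"
  shows "((\<lambda>t. tpoly_eval P (X t)) \<longlongrightarrow> tpoly_eval P x) F"
proof -
  have "((\<lambda>t. Max (insert 0 ((\<lambda>m. P m * mono_val (X t) m) ` S))) \<longlongrightarrow>
      Max (insert 0 ((\<lambda>m. P m * mono_val x m) ` S))) F" if "finite S" for S
    using that
  proof (induction S rule: finite_induct)
    case (insert a S)
    have Max_insert_term: "Max (insert 0 ((\<lambda>m. P m * mono_val z m) ` insert a S)) =
        max (P a * mono_val z a) (Max (insert 0 ((\<lambda>m. P m * mono_val z m) ` S)))" for z
      using insert.hyps by (subst image_insert, subst insert_commute, subst Max_insert) auto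
    show ?case
      unfolding Max_insert_term
      by (intro tendsto_max insert.IH tendsto_mult tendsto_const tendsto_mono_val lim_X)
  qed simp
  then show ?thesis unfolding tpoly_eval_def using is_tpoly_finite[OF P] by blast
qed

lemma tpoly_eval_eq_if_eq_on_positive:
  assumes P: "is_tpoly P" and Q: "is_tpoly Q"
    and eq: "\<And>z. \<forall>i. 0 < z i \<Longrightarrow> tpoly_eval P z = tpoly_eval Q z" and nonneg: "\<forall>i. 0 \<le> x i"
  shows "tpoly_eval P x = tpoly_eval Q x"
proof (rule tendsto_unique[OF trivial_limit_at_right_real])
  have "((\<lambda>t. x i + t) \<longlongrightarrow> x i + 0) (at_right 0)" for i by (intro tendsto_intros)
  then have lim: "((\<lambda>t. x i + t) \<longlongrightarrow> x i) (at_right 0)" for i by simp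
  show "((\<lambda>t. tpoly_eval P (\<lambda>i. x i + t)) \<longlongrightarrow> tpoly_eval P x) (at_right 0)"
    by (rule tendsto_tpoly_eval[OF P lim])
  have "\<forall>\<^sub>F t in at_right 0. tpoly_eval Q (\<lambda>i. x i + t) = tpoly_eval P (\<lambda>i. x i + t)"
    using eventually_at_right_less by (rule eventually_mono) (simp add: eq add_nonneg_pos nonneg)
  then show "((\<lambda>t. tpoly_eval P (\<lambda>i. x i + t)) \<longlongrightarrow> tpoly_eval Q x) (at_right 0)"
    by (rule Lim_transform_eventually[OF tendsto_tpoly_eval[OF Q lim]])
qed

lemma tpoly_equiv_eval_eq:
  fixes P Q :: "'n::finite tpoly"
  assumes P: "is_tpoly P" and Q: "is_tpoly Q" and equiv: "tpoly_equiv P Q" and nonneg: "\<forall>i. 0 \<le> x i"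
  shows "tpoly_eval P x = tpoly_eval Q x"
proof (rule tpoly_eval_eq_if_eq_on_positive[OF P Q _ nonneg])
  fix z :: "'n \<Rightarrow> real" assume z: "\<forall>i. 0 < z i"
  from equiv obtain W where W: "is_tpoly W" "W \<noteq> tpoly_zero" "tpoly_mult W P = tpoly_mult W Q"
    by (auto simp: tpoly_equiv_def)
  have "tpoly_eval W z * tpoly_eval P z = tpoly_eval W z * tpoly_eval Q z"
    using W z by (simp add: less_imp_le P Q flip: tpoly_eval_mult)
  then show "tpoly_eval P z = tpoly_eval Q z"
    using tpoly_eval_pos[OF W(1,2) z] by simp
qed

section \<open>Dominant monomials\<close>

definition dominant_at :: "'n::finite tpoly \<Rightarrow> ('n \<Rightarrow> real) \<Rightarrow> ('n \<Rightarrow> nat) \<Rightarrow> bool" where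
  "dominant_at P x a \<longleftrightarrow> 0 < P a * mono_val x a \<and>
     (\<forall>c. c \<noteq> a \<longrightarrow> P c * mono_val x c < P a * mono_val x a)"

lemma dominant_at_nonzero: "dominant_at P x a \<Longrightarrow> P a \<noteq> 0"
  by (auto simp: dominant_at_def)

lemma dominant_at_le: "dominant_at P x a \<Longrightarrow> P c * mono_val x c \<le> P a * mono_val x a"
  unfolding dominant_at_def by (cases "c = a") (auto intro: less_imp_le)

lemma dominant_at_unique: "dominant_at P x a \<Longrightarrow> dominant_at P x b \<Longrightarrow> a = b"
  unfolding dominant_at_def by (metis less_asym)

lemma tpoly_eval_dominant:
  assumes P: "is_tpoly P" and dominant: "dominant_at P x a"
  shows "tpoly_eval P x = P a * mono_val x a"
proof (rule order_antisym)
  show "tpoly_eval P x \<le> P a * mono_val x a"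
    using dominant by (intro tpoly_eval_leI[OF P] dominant_at_le) (simp add: dominant_at_def)
qed (rule tpoly_eval_ge[OF P])

lemma dominant_at_iff_eval:
  assumes P: "is_tpoly P"
  shows "dominant_at P x a \<longleftrightarrow> tpoly_eval P x \<noteq> 0 \<and> {c. P c * mono_val x c = tpoly_eval P x} = {a}"
proof
  assume "dominant_at P x a"
  then show "tpoly_eval P x \<noteq> 0 \<and> {c. P c * mono_val x c = tpoly_eval P x} = {a}"
    unfolding tpoly_eval_dominant[OF P \<open>dominant_at P x a\<close>] by (force simp: dominant_at_def)
next
  assume eval: "tpoly_eval P x \<noteq> 0 \<and> {c. P c * mono_val x c = tpoly_eval P x} = {a}"
  then have "P a * mono_val x a = tpoly_eval P x" by blast
  moreover have "P c * mono_val x c < tpoly_eval P x" if "c \<noteq> a" for c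
    using eval that tpoly_eval_ge[OF P, of c x] by force
  ultimately show "dominant_at P x a"
    using eval tpoly_eval_nonneg[OF P, of x] by (simp add: dominant_at_def)
qed

lemma is_tzero_iff_eval:
  assumes P: "is_tpoly P" and nonneg: "\<forall>i. 0 \<le> x i"
  shows "is_tzero P x \<longleftrightarrow> tpoly_eval P x = 0 \<or>
    (\<exists>a b. a \<noteq> b \<and> P a * mono_val x a = tpoly_eval P x \<and> P b * mono_val x b = tpoly_eval P x)"
proof -
  have vanish: "(\<forall>m. P m * mono_val x m = 0) \<longleftrightarrow> tpoly_eval P x = 0"
    using tpoly_eval_attained[OF P, of x] tpoly_eval_ge[OF P, of _ x] tpoly_term_nonneg[OF P nonneg]
    by (metis order_antisym)
  have maximal: "(\<forall>c. P c * mono_val x c \<le> P a * mono_val x a) \<longleftrightarrow>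
      P a * mono_val x a = tpoly_eval P x" for a
    using tpoly_eval_attained[OF P, of x] tpoly_eval_ge[OF P, of _ x] tpoly_term_nonneg[OF P nonneg]
    by (metis order_antisym)
  show ?thesis
    unfolding is_tzero_def vanish maximal by (metis mult_zero_left)
qed

lemma not_is_tzero_iff:
  assumes P: "is_tpoly P" and "\<forall>i. 0 \<le> x i"
  shows "\<not> is_tzero P x \<longleftrightarrow> (\<exists>a. dominant_at P x a)"
  unfolding is_tzero_iff_eval[OF assms] dominant_at_iff_eval[OF P]
  using maximal_monomial_exists[OF P, of x] by (auto simp: set_eq_iff)

lemma is_tzero_mult_left:
  assumes P: "is_tpoly P" and Q: "is_tpoly Q" and nonneg: "\<forall>i. 0 \<le> x i" and zero: "is_tzero P x"
  shows "is_tzero (tpoly_mult P Q) x"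
proof -
  have PQ: "is_tpoly (tpoly_mult P Q)" using P Q by (rule is_tpoly_mult)
  have eval: "tpoly_eval (tpoly_mult P Q) x = tpoly_eval P x * tpoly_eval Q x"
    by (rule tpoly_eval_mult[OF P Q nonneg])
  consider (vanishing) "tpoly_eval (tpoly_mult P Q) x = 0"
    | (tie) a b r where "a \<noteq> b" "P a * mono_val x a = tpoly_eval P x"
        "P b * mono_val x b = tpoly_eval P x" "Q r * mono_val x r = tpoly_eval Q x"
    using zero[unfolded is_tzero_iff_eval[OF P nonneg]] tpoly_eval_attained[OF Q, of x] eval
    by (metis mult_zero_left mult_zero_right)
  then show ?thesis
  proof cases
    case vanishing
    then show ?thesis by (simp add: is_tzero_iff_eval[OF PQ nonneg])
  next
    case tie
    have attained: "tpoly_mult P Q (\<lambda>i. c i + r i) * mono_val x (\<lambda>i. c i + r i) =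
        tpoly_eval (tpoly_mult P Q) x"
      if "P c * mono_val x c = tpoly_eval P x" for c
      using tpoly_mult_term_ge[OF nonneg, of P c Q r] tpoly_eval_ge[OF PQ, of "\<lambda>i. c i + r i" x]
        that tie(4) eval
      by (intro order_antisym) auto
    have "(\<lambda>i. a i + r i) \<noteq> (\<lambda>i. b i + r i)" using tie(1) by (simp add: fun_eq_iff)
    with attained[OF tie(2)] attained[OF tie(3)] show ?thesis
      unfolding is_tzero_iff_eval[OF PQ nonneg] by blast
  qed
qed

lemma dominant_at_one: "dominant_at tpoly_one x (\<lambda>i. 0)"
  by (simp add: dominant_at_def tpoly_one_def mono_val_def)

lemma dominant_at_mult:
  assumes P: "is_tpoly P" and Q: "is_tpoly Q" and nonneg: "\<forall>i. 0 \<le> x i"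
    and dom_P: "dominant_at P x a" and dom_Q: "dominant_at Q x b"
  shows "dominant_at (tpoly_mult P Q) x (\<lambda>i. a i + b i)"
proof -
  let ?PQ = "tpoly_mult P Q" and ?ab = "\<lambda>i. a i + b i"
  let ?A = "P a * mono_val x a" and ?B = "Q b * mono_val x b"
  have pos: "0 < ?A" "0 < ?B" using dom_P dom_Q by (simp_all add: dominant_at_def)
  have "?A * ?B \<le> ?PQ ?ab * mono_val x ?ab" by (rule tpoly_mult_term_ge[OF nonneg])
  moreover have "?PQ c * mono_val x c < ?A * ?B" if "c \<noteq> ?ab" for c
  proof (cases rule: tpoly_mult_cases[of P Q c])
    case zero
    then show ?thesis using pos by simp
  next
    case (product p q)
    then have "p \<noteq> a \<or> q \<noteq> b" using that by auto
    then have "(P p * mono_val x p) * (Q q * mono_val x q) < ?A * ?B"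
    proof
      assume "p \<noteq> a"
      have "(P p * mono_val x p) * (Q q * mono_val x q) \<le> (P p * mono_val x p) * ?B"
        by (rule mult_left_mono[OF dominant_at_le[OF dom_Q] tpoly_term_nonneg[OF P nonneg]])
      also have "\<dots> < ?A * ?B"
        using dom_P \<open>p \<noteq> a\<close> pos by (intro mult_strict_right_mono) (simp_all add: dominant_at_def)
      finally show ?thesis .
    next
      assume "q \<noteq> b"
      have "(P p * mono_val x p) * (Q q * mono_val x q) \<le> ?A * (Q q * mono_val x q)"
        by (rule mult_right_mono[OF dominant_at_le[OF dom_P] tpoly_term_nonneg[OF Q nonneg]])
      also have "\<dots> < ?A * ?B"
        using dom_Q \<open>q \<noteq> b\<close> pos by (intro mult_strict_left_mono) (simp_all add: dominant_at_def)
      finally show ?thesis .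
    qed
    then show ?thesis unfolding product(2) by (simp add: product(1) mono_val_add mult_ac)
  qed
  ultimately show ?thesis
    unfolding dominant_at_def using mult_pos_pos[OF pos] by (meson less_le_trans)
qed

lemma dominant_at_pow:
  assumes "is_tpoly P" "\<forall>i. 0 \<le> x i" "dominant_at P x a"
  shows "dominant_at (tpoly_pow P k) x (\<lambda>i. k * a i)"
proof (induction k)
  case 0
  show ?case by (simp add: dominant_at_one)
next
  case (Suc k)
  with dominant_at_mult[OF assms(1) is_tpoly_pow[OF assms(1)] assms(2,3)] show ?case by simp
qed

lemma eventually_dominant_atI:
  assumes "is_tpoly P" and "\<forall>\<^sub>F t in F. 0 < P a * mono_val (X t) a"
    and "\<And>c. P c \<noteq> 0 \<Longrightarrow> c \<noteq> a \<Longrightarrow> \<forall>\<^sub>F t in F. P c * mono_val (X t) c < P a * mono_val (X t) a"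
  shows "\<forall>\<^sub>F t in F. dominant_at P (X t) a"
proof -
  have "\<forall>\<^sub>F t in F. \<forall>c\<in>{c. P c \<noteq> 0} - {a}. P c * mono_val (X t) c < P a * mono_val (X t) a"
    by (rule eventually_ball_finite) (use assms in \<open>auto simp: is_tpoly_finite\<close>)
  with assms(2) show ?thesis
  proof eventually_elim
    case (elim t)
    have "P c * mono_val (X t) c < P a * mono_val (X t) a" if "c \<noteq> a" for c
      using elim that by (cases "P c = 0") auto
    with elim(1) show ?case by (simp add: dominant_at_def)
  qed
qed

lemma eventually_less_if_tendsto:
  fixes f g :: "'b \<Rightarrow> real"
  assumes "(f \<longlongrightarrow> l) F" "(g \<longlongrightarrow> m) F" "l < m"
  shows "\<forall>\<^sub>F t in F. f t < g t"
proof -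
  have "\<forall>\<^sub>F t in F. 0 < g t - f t"
    by (rule order_tendstoD(1)[OF tendsto_diff[OF assms(2,1)]]) (use assms(3) in simp)
  then show ?thesis by (rule eventually_mono) simp
qed

lemma eventually_dominant_at:
  assumes P: "is_tpoly P" and lim_X: "\<And>i. ((\<lambda>t. X t i) \<longlongrightarrow> x i) F" and dominant: "dominant_at P x a"
  shows "\<forall>\<^sub>F t in F. dominant_at P (X t) a"
proof (rule eventually_dominant_atI[OF P])
  have lim: "((\<lambda>t. P c * mono_val (X t) c) \<longlongrightarrow> P c * mono_val x c) F" for c
    by (intro tendsto_mult tendsto_const tendsto_mono_val lim_X)
  show "\<forall>\<^sub>F t in F. 0 < P a * mono_val (X t) a"
    by (rule order_tendstoD(1)[OF lim]) (use dominant in \<open>simp add: dominant_at_def\<close>)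
  show "\<forall>\<^sub>F t in F. P c * mono_val (X t) c < P a * mono_val (X t) a" if "c \<noteq> a" for c
    by (rule eventually_less_if_tendsto[OF lim lim])
      (use dominant that in \<open>simp add: dominant_at_def\<close>)
qed

lemma dominant_at_constant_on_path:
  assumes P: "is_tpoly P" and "connected T" and cont: "\<And>i. continuous_on T (\<lambda>t. X t i)"
    and dominant: "\<And>t. t \<in> T \<Longrightarrow> dominant_at P (X t) (e t)" and "s \<in> T" "t \<in> T"
  shows "e s = e t"
proof (rule connected_local_const[OF \<open>connected T\<close> \<open>s \<in> T\<close> \<open>t \<in> T\<close>], rule ballI)
  fix t assume t: "t \<in> T"
  have "\<forall>\<^sub>F s in at t within T. dominant_at P (X s) (e t)"
    using cont t
    by (intro eventually_dominant_at[OF P _ dominant[OF t]]) (simp add: continuous_on_def)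
  moreover have "\<forall>\<^sub>F s in at t within T. s \<in> T" by (simp add: eventually_at_filter)
  ultimately show "\<forall>\<^sub>F s in at t within T. e t = e s"
    by eventually_elim (use dominant dominant_at_unique in blast)
qed

definition weight :: "('n::finite \<Rightarrow> nat) \<Rightarrow> ('n \<Rightarrow> real) \<Rightarrow> real" where
  "weight m d = (\<Sum>i\<in>UNIV. real (m i) * d i)"

abbreviation exp_point :: "('n \<Rightarrow> real) \<Rightarrow> 'n \<Rightarrow> real" where
  "exp_point y \<equiv> \<lambda>i. exp (y i)"

lemma mono_val_exp: "mono_val (exp_point y) m = exp (weight m y)"
  by (simp add: mono_val_def weight_def exp_sum exp_of_nat_mult)

lemma mono_val_scaled: "mono_val (\<lambda>i. x i * exp (t * d i)) m = mono_val x m * exp (t * weight m d)"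
proof -
  have "mono_val (\<lambda>i. x i * exp (t * d i)) m = mono_val x m * mono_val (\<lambda>i. exp (t * d i)) m"
    by (simp add: mono_val_def power_mult_distrib prod.distrib)
  then show ?thesis
    by (simp add: mono_val_exp weight_def sum_distrib_left mult.left_commute)
qed

lemma tendsto_scaled: "((\<lambda>t. x * exp (t * d)) \<longlongrightarrow> x) (at_right (0::real))" for x d :: real
proof -
  have "((\<lambda>t. x * exp (t * d)) \<longlongrightarrow> x * exp (0 * d)) (at_right 0)" by (intro tendsto_intros)
  then show ?thesis by simp
qed

text \<open>The longest vector is an exposed point, in its own direction.\<close>

lemma finite_exposed_exponent:
  fixes M :: "('n::finite \<Rightarrow> nat) set"
  assumes "finite M" "M \<noteq> {}"
  obtains a d where "a \<in> M" "\<And>c. c \<in> M \<Longrightarrow> c \<noteq> a \<Longrightarrow> weight c d < weight a d"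
proof -
  define square where "square c = weight c (\<lambda>i. real (c i))" for c :: "'n \<Rightarrow> nat"
  obtain a where a: "a \<in> M" "Max (square ` M) = square a"
    using assms by (rule obtains_MAX)
  have longest: "square c \<le> square a" if "c \<in> M" for c
    unfolding a(2)[symmetric] using assms(1) that by simp
  have "weight c (\<lambda>i. real (a i)) < weight a (\<lambda>i. real (a i))" if "c \<in> M" "c \<noteq> a" for c
  proof -
    from \<open>c \<noteq> a\<close> obtain i where "c i \<noteq> a i" by auto
    then have "0 < (\<Sum>i\<in>UNIV. (real (c i) - real (a i)) * (real (c i) - real (a i)))"
      by (intro sum_pos2[of _ i]) (auto simp: zero_less_mult_iff)
    also have "\<dots> = square c + square a - 2 * weight c (\<lambda>i. real (a i))"
      by (simp add: square_def weight_def algebra_simps sum.distrib sum_subtractf sum_distrib_left)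
    finally show ?thesis using longest[OF \<open>c \<in> M\<close>] by (simp add: square_def)
  qed
  with a(1) show ?thesis by (rule that)
qed

lemma eventually_dominant_in_some_direction:
  fixes P :: "'n::finite tpoly"
  assumes P: "is_tpoly P" and "tpoly_eval P x \<noteq> 0"
  shows "\<exists>a d. \<forall>\<^sub>F t in at_right 0. dominant_at P (\<lambda>i. x i * exp (t * d i)) a"
proof -
  define M where "M = {m. P m * mono_val x m = tpoly_eval P x}"
  have "M \<noteq> {}" using maximal_monomial_exists[OF assms] by (simp add: M_def)
  have "P m \<noteq> 0" if "m \<in> M" for m using that assms(2) by (auto simp: M_def)
  then have "finite M" by (intro finite_subset[OF _ is_tpoly_finite[OF P]] subsetI) simp
  then obtain a d where "a \<in> M" and exposed: "\<And>c. c \<in> M \<Longrightarrow> c \<noteq> a \<Longrightarrow> weight c d < weight a d"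
    using finite_exposed_exponent \<open>M \<noteq> {}\<close> by blast
  have max: "P a * mono_val x a = tpoly_eval P x" using \<open>a \<in> M\<close> by (simp add: M_def)
  have pos: "0 < tpoly_eval P x" using assms(2) tpoly_eval_nonneg[OF P, of x] by simp
  let ?z = "\<lambda>t i. x i * exp (t * d i)"
  have scaled: "P c * mono_val (?z t) c = P c * mono_val x c * exp (t * weight c d)" for t c
    by (simp add: mono_val_scaled)
  have lim: "((\<lambda>t. P c * mono_val (?z t) c) \<longlongrightarrow> P c * mono_val x c) (at_right 0)" for c
    by (intro tendsto_mult tendsto_const tendsto_mono_val tendsto_scaled)
  have "\<forall>\<^sub>F t in at_right 0. dominant_at P (?z t) a"
  proof (rule eventually_dominant_atI[OF P])
    show "\<forall>\<^sub>F t in at_right 0. 0 < P a * mono_val (?z t) a"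
      unfolding scaled max using pos by simp
    show "\<forall>\<^sub>F t in at_right 0. P c * mono_val (?z t) c < P a * mono_val (?z t) a" if "c \<noteq> a" for c
    proof (cases "c \<in> M")
      case True
      then have "P c * mono_val (?z t) c < P a * mono_val (?z t) a" if "0 < t" for t
        unfolding scaled max using exposed[OF True \<open>c \<noteq> a\<close>] pos that by (simp add: M_def)
      then show ?thesis using eventually_at_right_less by (rule eventually_mono[rotated])
    next
      case False
      then have "P c * mono_val x c < P a * mono_val x a"
        using tpoly_eval_ge[OF P, of c x] by (simp add: M_def max)
      then show ?thesis by (rule eventually_less_if_tendsto[OF lim lim])
    qed
  qed
  then show ?thesis by blast
qed

text \<open>Moving from \<open>x\<close> in the direction \<open>a - b\<close>, the term of \<open>a\<close> would outgrow the one of \<open>b\<close>.\<close>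

lemma dominant_at_cong_eval:
  fixes P Q :: "'n::finite tpoly"
  assumes P: "is_tpoly P" and Q: "is_tpoly Q"
    and eval: "\<And>z. \<forall>i. 0 \<le> z i \<Longrightarrow> tpoly_eval P z = tpoly_eval Q z"
    and nonneg: "\<forall>i. 0 \<le> x i" and dominant: "dominant_at P x b"
  shows "dominant_at Q x b"
proof -
  have "a = b" if maximal: "Q a * mono_val x a = tpoly_eval Q x" for a
  proof -
    define d where "d i = real (a i) - real (b i)" for i
    have "\<forall>\<^sub>F t in at_right 0. 0 < t \<and> dominant_at P (\<lambda>i. x i * exp (t * d i)) b"
      by (intro eventually_conj eventually_at_right_less
          eventually_dominant_at[OF P tendsto_scaled dominant])
    then obtain t where t: "0 < t" "dominant_at P (\<lambda>i. x i * exp (t * d i)) b"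
      using eventually_happens'[OF trivial_limit_at_right_real] by blast
    let ?z = "\<lambda>i. x i * exp (t * d i)"
    have "Q a * mono_val ?z a \<le> tpoly_eval Q ?z" by (rule tpoly_eval_ge[OF Q])
    also have "\<dots> = P b * mono_val ?z b"
      using eval[of ?z] nonneg by (simp add: tpoly_eval_dominant[OF P t(2)])
    finally have "(Q a * mono_val x a) * exp (t * weight a d) \<le>
        (P b * mono_val x b) * exp (t * weight b d)"
      by (simp add: mono_val_scaled mult.assoc)
    moreover have "Q a * mono_val x a = P b * mono_val x b"
      using maximal eval[OF nonneg] by (simp add: tpoly_eval_dominant[OF P dominant])
    moreover have "0 < P b * mono_val x b" using dominant by (simp add: dominant_at_def)
    ultimately have "exp (t * weight a d) \<le> exp (t * weight b d)"
      by (simp only: mult_le_cancel_left_pos)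
    then have "weight a d - weight b d \<le> 0" using t(1) by simp
    also have "weight a d - weight b d = (\<Sum>i\<in>UNIV. d i * d i)"
      by (simp add: weight_def d_def algebra_simps flip: sum_subtractf)
    finally have "(\<Sum>i\<in>UNIV. d i * d i) = 0" by (intro order_antisym sum_nonneg) auto
    then have "d i * d i = 0" for i by (subst (asm) sum_nonneg_eq_0_iff) auto
    then show ?thesis by (auto simp: d_def)
  qed
  moreover have "tpoly_eval Q x \<noteq> 0"
    using dominant eval[OF nonneg] tpoly_eval_dominant[OF P dominant] by (simp add: dominant_at_def)
  moreover from this obtain a where "Q a * mono_val x a = tpoly_eval Q x"
    using maximal_monomial_exists[OF Q] by blast
  ultimately show ?thesis unfolding dominant_at_iff_eval[OF Q] by blast
qed

section \<open>Zeros of divisors\<close>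

lemma tvar_subset_if_dvd_pow:
  fixes P Q :: "'n::finite tpoly"
  assumes P: "is_tpoly P" and Q: "is_tpoly Q" and dvd: "tpoly_dvd P (tpoly_pow Q k)"
  shows "tvar P \<subseteq> tvar Q"
proof
  fix x assume "x \<in> tvar P"
  then have nonneg: "\<forall>i. 0 \<le> x i" and zero: "is_tzero P x" by (auto simp: tvar_def)
  from dvd obtain R where R: "is_tpoly R" and equiv: "tpoly_equiv (tpoly_pow Q k) (tpoly_mult P R)"
    by (auto simp: tpoly_dvd_def)
  have tpolys: "is_tpoly (tpoly_pow Q k)" "is_tpoly (tpoly_mult P R)"
    using P Q R by (simp_all add: is_tpoly_pow is_tpoly_mult)
  have "is_tzero Q x"
  proof (rule ccontr)
    assume "\<not> is_tzero Q x"
    then obtain b where "dominant_at Q x b" using not_is_tzero_iff[OF Q nonneg] by blast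
    then have "dominant_at (tpoly_mult P R) x (\<lambda>i. k * b i)"
      using dominant_at_cong_eval[OF tpolys tpoly_equiv_eval_eq[OF tpolys equiv] nonneg]
        dominant_at_pow[OF Q nonneg] by blast
    then show False
      using not_is_tzero_iff[OF tpolys(2) nonneg] is_tzero_mult_left[OF P R nonneg zero] by blast
  qed
  with nonneg show "x \<in> tvar Q" by (simp add: tvar_def)
qed

section \<open>Equality of polynomial functions\<close>

definition log_val :: "'n::finite tpoly \<Rightarrow> ('n \<Rightarrow> nat) \<Rightarrow> ('n \<Rightarrow> real) \<Rightarrow> real" where
  "log_val P m y = ln (P m) + weight m y"

definition log_quotient ::
  "'n::finite tpoly \<Rightarrow> ('n \<Rightarrow> nat) \<Rightarrow> 'n tpoly \<Rightarrow> ('n \<Rightarrow> nat) \<Rightarrow> ('n \<Rightarrow> int) \<times> real" where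
  "log_quotient P a Q b = (\<lambda>i. int (a i) - int (b i), ln (P a) - ln (Q b))"

lemma exp_log_val: "is_tpoly P \<Longrightarrow> P m \<noteq> 0 \<Longrightarrow> exp (log_val P m y) = P m * mono_val (exp_point y) m"
  by (simp add: log_val_def mono_val_exp exp_add is_tpoly_pos)

lemma affine_value_log_quotient:
  "affine_value (log_quotient P a Q b) y = log_val P a y - log_val Q b y"
  by (simp add: affine_value_def log_quotient_def log_val_def weight_def
      left_diff_distrib sum_subtractf)

lemma sum_closure_log_quotient:
  fixes P :: "'n::finite tpoly"
  assumes P: "is_tpoly P" and M: "is_tpoly M" "M m \<noteq> 0"
    and "(v, d) \<in> sum_closure (log_quotient M m P ` {a. P a \<noteq> 0})"
  shows "\<exists>n>0. \<exists>u. (\<forall>i. int (u i) = int n * int (m i) - v i) \<and> M m ^ n \<le> exp d * tpoly_pow P n u"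
  using assms(4)
proof (induction "(v, d)" arbitrary: v d)
  case base
  then obtain a where a: "P a \<noteq> 0" "v = (\<lambda>i. int (m i) - int (a i))" "d = ln (M m) - ln (P a)"
    by (auto simp: log_quotient_def)
  moreover have "M m \<le> exp d * tpoly_pow P 1 a"
    unfolding tpoly_pow_one[OF P] a(3) using P a(1) M by (simp add: exp_diff is_tpoly_pos)
  ultimately show ?case by (intro exI[of _ 1]) (auto intro!: exI[of _ a])
next
  case (add u c v d)
  then obtain k l p q where "0 < k"
    and exponents: "\<forall>i. int (p i) = int k * int (m i) - u i"
      "\<forall>i. int (q i) = int l * int (m i) - v i"
    and powers: "M m ^ k \<le> exp c * tpoly_pow P k p" "M m ^ l \<le> exp d * tpoly_pow P l q"
    by metis
  have "M m ^ (k + l) \<le> (exp c * tpoly_pow P k p) * (exp d * tpoly_pow P l q)"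
    unfolding power_add using powers M(1)
    by (intro mult_mono) (auto simp: is_tpoly_nonneg is_tpoly_pow P)
  also have "\<dots> = exp (c + d) * (tpoly_pow P k p * tpoly_pow P l q)" by (simp add: exp_add)
  also have "\<dots> \<le> exp (c + d) * tpoly_pow P (k + l) (\<lambda>i. p i + q i)"
    unfolding tpoly_pow_add[OF P] by (intro mult_left_mono tpoly_mult_ge) simp
  finally show ?case
    using \<open>0 < k\<close> exponents
    by (intro exI[of _ "k + l"] conjI exI[of _ "\<lambda>i. p i + q i"]) (auto simp: algebra_simps)
qed

lemma log_quotients_infeasible:
  assumes P: "is_tpoly P" and M: "is_tpoly M" "M m \<noteq> 0"
    and eval_ge: "\<And>y. M m * mono_val (exp_point y) m \<le> tpoly_eval P (exp_point y)"
  shows "\<nexists>y. \<forall>p\<in>log_quotient M m P ` {a. P a \<noteq> 0}. 0 < affine_value p y"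
proof
  assume "\<exists>y. \<forall>p\<in>log_quotient M m P ` {a. P a \<noteq> 0}. 0 < affine_value p y"
  then obtain y where less: "\<And>a. P a \<noteq> 0 \<Longrightarrow> log_val P a y < log_val M m y"
    by (auto simp: affine_value_log_quotient)
  have "tpoly_eval P (exp_point y) < exp (log_val M m y)"
    by (rule tpoly_eval_lessI[OF P]) (simp_all add: less flip: exp_log_val[OF P])
  with eval_ge[of y] show False by (simp add: exp_log_val[OF M])
qed

lemma monom_pow_le_if_eval_le:
  fixes P :: "'n::finite tpoly"
  assumes P: "is_tpoly P" and "0 < c"
    and eval_ge: "\<And>y. c * mono_val (exp_point y) m \<le> tpoly_eval P (exp_point y)"
  obtains n where "0 < n" "tpoly_pow (tpoly_monom c m) n \<le> tpoly_pow P n"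
proof -
  define M where "M = tpoly_monom c m"
  have M: "is_tpoly M" "M m = c" "M m \<noteq> 0"
    using \<open>0 < c\<close> by (auto simp: M_def is_tpoly_monom) (auto simp: tpoly_monom_def)
  let ?S = "log_quotient M m P ` {a. P a \<noteq> 0}"
  have "\<nexists>y. \<forall>p\<in>?S. 0 < affine_value p y"
    by (rule log_quotients_infeasible[OF P M(1,3)]) (simp add: M(2) eval_ge)
  then obtain d where "d \<le> 0" "(\<lambda>i. 0, d) \<in> sum_closure ?S"
    using strict_farkas[of ?S] is_tpoly_finite[OF P] by blast
  from sum_closure_log_quotient[OF P M(1,3) this(2)] obtain n u where "0 < n"
    and u: "\<forall>i. int (u i) = int n * int (m i)" and pow_le: "c ^ n \<le> exp d * tpoly_pow P n u"
    by (auto simp: M(2))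
  note pow_le
  also have "exp d * tpoly_pow P n u \<le> 1 * tpoly_pow P n u"
    by (rule mult_right_mono[OF _ is_tpoly_nonneg[OF is_tpoly_pow[OF P]]]) (use \<open>d \<le> 0\<close> in simp)
  also have "u = (\<lambda>i. n * m i)" using u by (simp add: fun_eq_iff flip: of_nat_mult)
  finally have "tpoly_monom (c ^ n) (\<lambda>i. n * m i) \<le> tpoly_pow P n"
    by (simp add: tpoly_monom_le_iff is_tpoly_pow P)
  then have "tpoly_pow (tpoly_monom c m) n \<le> tpoly_pow P n"
    using tpoly_pow_monom_le[of c m n] \<open>0 < c\<close> by (simp add: order_trans)
  with \<open>0 < n\<close> show ?thesis by (rule that)
qed

lemma rational_le_if_eval_le:
  fixes P Q :: "'n::finite tpoly"
  assumes P: "is_tpoly P" and Q: "is_tpoly Q"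
    and eval_le: "\<And>y. tpoly_eval P (exp_point y) \<le> tpoly_eval Q (exp_point y)"
  shows "rational_le P Q"
proof (rule rational_le_if_monom_le[OF P Q])
  fix m assume "P m \<noteq> 0"
  then have pos: "0 < P m" by (rule is_tpoly_pos[OF P])
  obtain n where n: "0 < n" "tpoly_pow (tpoly_monom (P m) m) n \<le> tpoly_pow Q n"
    using monom_pow_le_if_eval_le[OF Q pos order_trans[OF tpoly_eval_ge[OF P] eval_le]] .
  have "tpoly_monom (P m) m \<noteq> tpoly_zero"
    using pos by (auto simp: tpoly_nonzero_iff tpoly_monom_def)
  then show "rational_le (tpoly_monom (P m) m) Q"
    using rational_le_if_pow_le[OF is_tpoly_monom _ Q n] pos by simp
qed

lemma tpoly_equiv_if_eval_eq:
  fixes P Q :: "'n::finite tpoly"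
  assumes "is_tpoly P" "is_tpoly Q"
    and "\<And>y. tpoly_eval P (exp_point y) = tpoly_eval Q (exp_point y)"
  shows "tpoly_equiv P Q"
  using assms by (intro tpoly_equiv_if_rational_le rational_le_if_eval_le) simp_all

section \<open>Cells of linearity\<close>

definition cell :: "'n::finite tpoly \<Rightarrow> ('n \<Rightarrow> nat) \<Rightarrow> ('n \<Rightarrow> real) set" where
  "cell P a = {y. dominant_at P (exp_point y) a}"

lemma cell_nonzero: "y \<in> cell P a \<Longrightarrow> P a \<noteq> 0"
  by (simp add: cell_def dominant_at_nonzero)

lemma in_cell_iff:
  assumes P: "is_tpoly P"
  shows "y \<in> cell P a \<longleftrightarrow> P a \<noteq> 0 \<and> (\<forall>c. P c \<noteq> 0 \<longrightarrow> c \<noteq> a \<longrightarrow> log_val P c y < log_val P a y)"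
proof (cases "P a = 0")
  case False
  have "0 < P a * mono_val (exp_point y) a"
    using is_tpoly_pos[OF P False] by (simp add: mono_val_exp)
  moreover have "P c * mono_val (exp_point y) c < P a * mono_val (exp_point y) a \<longleftrightarrow>
      (P c \<noteq> 0 \<longrightarrow> log_val P c y < log_val P a y)" for c
    using calculation exp_log_val[OF P, symmetric] False by (cases "P c = 0") simp_all
  ultimately show ?thesis using False by (auto simp: cell_def dominant_at_def)
qed (auto dest: cell_nonzero)

lemma log_val_le_in_cell:
  "is_tpoly P \<Longrightarrow> y \<in> cell P a \<Longrightarrow> P c \<noteq> 0 \<Longrightarrow> log_val P c y \<le> log_val P a y"
  by (cases "c = a") (auto simp: in_cell_iff intro: less_imp_le)

lemma tpoly_eval_in_cell:
  assumes "is_tpoly P" "y \<in> cell P a"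
  shows "tpoly_eval P (exp_point y) = exp (log_val P a y)"
  using assms exp_log_val[OF assms(1) cell_nonzero[OF assms(2)]]
  by (simp add: cell_def tpoly_eval_dominant)

definition essential :: "'n::finite tpoly \<Rightarrow> ('n \<Rightarrow> nat) set" where
  "essential P = {a. cell P a \<noteq> {}}"

lemma essential_nonzero: "a \<in> essential P \<Longrightarrow> P a \<noteq> 0"
  by (auto simp: essential_def dest: cell_nonzero)

lemma finite_essential: "is_tpoly P \<Longrightarrow> finite (essential P)"
  by (rule finite_subset[OF _ is_tpoly_finite]) (auto dest: essential_nonzero)

lemma log_val_convex_combination:
  "log_val P m (\<lambda>i. (1 - t) * y i + t * z i) = (1 - t) * log_val P m y + t * log_val P m z"
  by (simp add: log_val_def weight_def algebra_simps sum.distrib sum_subtractf sum_distrib_left)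

lemma cell_convex:
  assumes P: "is_tpoly P" and "y \<in> cell P a" "z \<in> cell P a" and t: "0 \<le> t" "t \<le> 1"
  shows "(\<lambda>i. (1 - t) * y i + t * z i) \<in> cell P a"
proof -
  have "(1 - t) * log_val P c y + t * log_val P c z < (1 - t) * log_val P a y + t * log_val P a z"
    if "P c \<noteq> 0" "c \<noteq> a" for c
  proof (cases "t = 0")
    case False
    have "log_val P c y < log_val P a y" "log_val P c z < log_val P a z"
      using assms(2,3) that by (auto simp: in_cell_iff[OF P])
    then show ?thesis
      using False t by (intro add_le_less_mono mult_left_mono mult_strict_left_mono) auto
  qed (use assms(2) that in \<open>simp add: in_cell_iff[OF P]\<close>)
  then show ?thesis
    using cell_nonzero[OF assms(2)] by (simp add: in_cell_iff[OF P] log_val_convex_combination)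
qed

lemma tpoly_eval_eq_if_eq_on_cells:
  fixes P Q R :: "'n::finite tpoly"
  assumes R: "is_tpoly R" "R \<noteq> tpoly_zero" and P: "is_tpoly P" and Q: "is_tpoly Q"
    and eq: "\<And>y a. y \<in> cell R a \<Longrightarrow> tpoly_eval P (exp_point y) = tpoly_eval Q (exp_point y)"
  shows "tpoly_eval P (exp_point y) = tpoly_eval Q (exp_point y)"
proof -
  have "tpoly_eval R (exp_point y) \<noteq> 0" using tpoly_eval_pos[OF R, of "exp_point y"] by simp
  then obtain a d where dom: "\<forall>\<^sub>F t in at_right 0. dominant_at R (\<lambda>i. exp (y i) * exp (t * d i)) a"
    using eventually_dominant_in_some_direction[OF R(1)] by blast
  let ?z = "\<lambda>t i. exp (y i) * exp (t * d i)"
  have "tpoly_eval P (?z t) = tpoly_eval Q (?z t)" if "dominant_at R (?z t) a" for t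
    using eq[of "\<lambda>i. y i + t * d i" a] that by (simp add: cell_def exp_add)
  with dom have "\<forall>\<^sub>F t in at_right 0. tpoly_eval P (?z t) = tpoly_eval Q (?z t)"
    by (rule eventually_mono)
  from Lim_transform_eventually[OF tendsto_tpoly_eval[OF P tendsto_scaled] this]
  show ?thesis
    using tendsto_tpoly_eval[OF Q tendsto_scaled]
    by (rule tendsto_unique[OF trivial_limit_at_right_real])
qed

section \<open>Divisibility from inclusion of zeros\<close>

lemma dominant_at_if_tvar_subset:
  assumes "is_tpoly P" "is_tpoly Q" "tvar P \<subseteq> tvar Q" "\<forall>i. 0 \<le> x i" "dominant_at Q x b"
  obtains a where "dominant_at P x a"
  using assms not_is_tzero_iff[of P x] not_is_tzero_iff[of Q x] by (auto simp: tvar_def)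

lemma cells_refine_if_tvar_subset:
  fixes P Q :: "'n::finite tpoly"
  assumes P: "is_tpoly P" and Q: "is_tpoly Q" and sub: "tvar P \<subseteq> tvar Q"
  shows "\<exists>\<alpha>. \<forall>b. cell Q b \<subseteq> cell P (\<alpha> b)"
proof -
  have "\<exists>a. cell Q b \<subseteq> cell P a" for b
  proof (cases "cell Q b = {}")
    case False
    then obtain y where y_cell: "y \<in> cell Q b" by blast
    have cover: "\<exists>a. dominant_at P (exp_point z) a" if "z \<in> cell Q b" for z
      using dominant_at_if_tvar_subset[OF P Q sub, of "exp_point z" b] that by (auto simp: cell_def)
    then obtain a where dom_y: "dominant_at P (exp_point y) a" using y_cell by blast
    have "z \<in> cell P a" if z_cell: "z \<in> cell Q b" for z
    proof -
      define seg where "seg t i = (1 - t) * y i + t * z i" for t :: real and i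
      have "\<forall>t\<in>{0..1}. \<exists>e. dominant_at P (exp_point (seg t)) e"
        unfolding seg_def using cover[OF cell_convex[OF Q y_cell z_cell]] by simp
      then obtain e
        where dominant: "\<And>t. t \<in> {0..1} \<Longrightarrow> dominant_at P (exp_point (seg t)) (e t)" by metis
      have "continuous_on {0..1} (\<lambda>t. exp (seg t i))" for i
        unfolding seg_def by (intro continuous_intros)
      then have "e 0 = e 1"
        by (intro dominant_at_constant_on_path[where X = "\<lambda>t. exp_point (seg t)",
              OF P connected_Icc _ dominant]) auto
      moreover have "seg 0 = y" "seg 1 = z" by (simp_all add: seg_def fun_eq_iff)
      ultimately show ?thesis
        using dominant[of 0] dominant[of 1] dom_y by (auto simp: cell_def dest: dominant_at_unique)
    qed
    then show ?thesis by blast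
  qed blast
  then show ?thesis by metis
qed

text \<open>Setting the \<open>i\<close>-th coordinate to zero does not affect the dominance of \<open>b\<close>, but would
  kill \<open>a\<close>.\<close>

lemma exponent_zero_if_tvar_subset:
  fixes P Q :: "'n::finite tpoly"
  assumes P: "is_tpoly P" and Q: "is_tpoly Q" and sub: "tvar P \<subseteq> tvar Q"
    and y_cell: "y \<in> cell Q b" and cells: "cell Q b \<subseteq> cell P a" and "b i = 0"
  shows "a i = 0"
proof -
  define x where "x = (exp_point y)(i := 0)"
  have nonneg: "\<forall>j. 0 \<le> x j" by (simp add: x_def)
  have "mono_val x c \<le> mono_val (exp_point y) c" for c
    unfolding mono_val_def by (intro prod_mono conjI power_mono) (auto simp: x_def)
  then have "Q c * mono_val x c \<le> Q c * mono_val (exp_point y) c" for c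
    using is_tpoly_nonneg[OF Q] by (intro mult_left_mono)
  moreover have "mono_val x b = mono_val (exp_point y) b"
    unfolding mono_val_def by (rule prod.cong) (auto simp: x_def \<open>b i = 0\<close>)
  ultimately have dom_Q: "dominant_at Q x b"
    using y_cell by (auto simp: cell_def dominant_at_def intro: le_less_trans)
  then obtain e where dom_P: "dominant_at P x e"
    using dominant_at_if_tvar_subset[OF P Q sub nonneg] by blast
  then have "mono_val x e \<noteq> 0" by (auto simp: dominant_at_def)
  then have "e i = 0" by (auto simp: mono_val_def x_def)
  have lim: "((\<lambda>t. (x(i := t)) j) \<longlongrightarrow> x j) (at_right 0)" for j
    by (cases "j = i") (simp_all add: x_def)
  have "\<forall>\<^sub>F t in at_right 0. 0 < t \<and> dominant_at Q (x(i := t)) b \<and> dominant_at P (x(i := t)) e"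
    by (intro eventually_conj eventually_at_right_less eventually_dominant_at[OF Q lim dom_Q]
        eventually_dominant_at[OF P lim dom_P])
  then obtain t where t: "0 < t" "dominant_at Q (x(i := t)) b" "dominant_at P (x(i := t)) e"
    using eventually_happens'[OF trivial_limit_at_right_real] by blast
  have "x(i := t) = (\<lambda>j. exp ((y(i := ln t)) j))" using t(1) by (auto simp: x_def)
  with t(2) have "y(i := ln t) \<in> cell Q b" by (simp add: cell_def)
  with cells have "y(i := ln t) \<in> cell P a" by blast
  with \<open>x(i := t) = _\<close> t(3) have "e = a" by (auto simp: cell_def dest: dominant_at_unique)
  with \<open>e i = 0\<close> show ?thesis by simp
qed

text \<open>Farkas' lemma bounds \<open>a - a'\<close>, which is nonpositive on the cell of \<open>b'\<close>, by a combination of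
  the forms \<open>c - b'\<close> cutting out that cell; on the cell of \<open>b\<close> each of them is at most \<open>b - b'\<close>.\<close>

lemma eventually_slope_bounded_between_cells:
  fixes P Q :: "'n::finite tpoly"
  assumes P: "is_tpoly P" and Q: "is_tpoly Q" and w_cell: "w \<in> cell Q b'"
    and cells: "cell Q b' \<subseteq> cell P a'" and "P a \<noteq> 0"
  shows "\<forall>\<^sub>F k in sequentially. \<forall>y\<in>cell Q b.
    log_val P a y - log_val P a' y \<le> real k * (log_val Q b y - log_val Q b' y)"
proof -
  let ?S = "log_quotient Q b' Q ` {c. Q c \<noteq> 0 \<and> c \<noteq> b'}"
  let ?gap = "\<lambda>y. log_val Q b y - log_val Q b' y"
  have "finite ?S" using is_tpoly_finite[OF Q] by simp
  moreover have cell_iff: "(\<forall>p\<in>?S. 0 < affine_value p y) \<longleftrightarrow> y \<in> cell Q b'" for y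
    using cell_nonzero[OF w_cell] by (auto simp: in_cell_iff[OF Q] affine_value_log_quotient)
  then have "\<forall>p\<in>?S. 0 < affine_value p w" using w_cell by blast
  moreover have "affine_value (log_quotient P a P a') y \<le> 0" if "\<forall>p\<in>?S. 0 < affine_value p y" for y
    using that cells log_val_le_in_cell[OF P _ \<open>P a \<noteq> 0\<close>]
    unfolding cell_iff by (auto simp: affine_value_log_quotient)
  moreover have gap: "\<forall>y\<in>cell Q b. 0 \<le> ?gap y"
    using log_val_le_in_cell[OF Q _ cell_nonzero[OF w_cell]] by simp
  moreover have "\<forall>y\<in>cell Q b. \<forall>p\<in>?S. - ?gap y \<le> affine_value p y"
    using log_val_le_in_cell[OF Q] by (auto simp: affine_value_log_quotient)
  ultimately have "\<exists>K::nat. \<forall>y\<in>cell Q b. affine_value (log_quotient P a P a') y \<le> real K * ?gap y"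
    by (rule strict_farkas_bound)
  then obtain K :: nat where slope: "\<forall>y\<in>cell Q b. log_val P a y - log_val P a' y \<le> real K * ?gap y"
    by (auto simp: affine_value_log_quotient)
  have "\<forall>y\<in>cell Q b. log_val P a y - log_val P a' y \<le> real k * ?gap y" if "K \<le> k" for k
    using slope gap mult_right_mono[of "real K" "real k"] that by (meson of_nat_mono order_trans)
  then show ?thesis using eventually_ge_at_top[of K] by (rule eventually_mono[rotated])
qed

text \<open>For such \<open>k\<close> the subtractions in the definition of \<open>cell_quotient\<close> below are not truncated, and
  its term for \<open>b\<close> is the largest one on the cell of \<open>b\<close>.\<close>

definition dividing_power ::
  "'n::finite tpoly \<Rightarrow> 'n tpoly \<Rightarrow> (('n \<Rightarrow> nat) \<Rightarrow> 'n \<Rightarrow> nat) \<Rightarrow> nat \<Rightarrow> bool" where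
  "dividing_power P Q \<alpha> k \<longleftrightarrow> (\<forall>b\<in>essential Q. \<forall>i. \<alpha> b i \<le> k * b i) \<and>
     (\<forall>b\<in>essential Q. \<forall>b'\<in>essential Q. \<forall>y\<in>cell Q b.
       log_val P (\<alpha> b) y - log_val P (\<alpha> b') y \<le> real k * (log_val Q b y - log_val Q b' y))"

lemma eventually_dividing_power:
  fixes P Q :: "'n::finite tpoly"
  assumes P: "is_tpoly P" and Q: "is_tpoly Q" and sub: "tvar P \<subseteq> tvar Q"
    and cells: "\<forall>b. cell Q b \<subseteq> cell P (\<alpha> b)"
  shows "\<forall>\<^sub>F k in sequentially. dividing_power P Q \<alpha> k"
proof -
  have exponents: "\<forall>\<^sub>F k in sequentially. \<alpha> b i \<le> k * b i" if "b \<in> essential Q" for b i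
  proof (cases "b i = 0")
    case True
    from that obtain y where "y \<in> cell Q b" by (auto simp: essential_def)
    then have "\<alpha> b i = 0" using exponent_zero_if_tvar_subset[OF P Q sub] cells True by blast
    then show ?thesis by simp
  next
    case False
    have "\<alpha> b i \<le> k * b i" if "\<alpha> b i \<le> k" for k
      using mult_le_mono[OF that, of 1 "b i"] False by simp
    then show ?thesis using eventually_ge_at_top[of "\<alpha> b i"] by (rule eventually_mono[rotated])
  qed
  have slopes: "\<forall>\<^sub>F k in sequentially. \<forall>y\<in>cell Q b.
      log_val P (\<alpha> b) y - log_val P (\<alpha> b') y \<le> real k * (log_val Q b y - log_val Q b' y)"
    if "b \<in> essential Q" "b' \<in> essential Q" for b b'
  proof -
    from that obtain y w where "y \<in> cell Q b" "w \<in> cell Q b'" by (auto simp: essential_def)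
    moreover from this have "P (\<alpha> b) \<noteq> 0" using cells cell_nonzero by blast
    ultimately show ?thesis using eventually_slope_bounded_between_cells[OF P Q] cells by blast
  qed
  show ?thesis
    unfolding dividing_power_def
    by (intro eventually_conj eventually_ball_finite eventually_all_finite ballI
        finite_essential[OF Q] exponents slopes)
qed

definition monomial_max :: "'b set \<Rightarrow> ('b \<Rightarrow> real) \<Rightarrow> ('b \<Rightarrow> 'n \<Rightarrow> nat) \<Rightarrow> 'n tpoly" where
  "monomial_max E c r m = Max (insert 0 (c ` {b \<in> E. r b = m}))"

lemma monomial_max_cases:
  assumes "finite E"
  obtains (zero) "monomial_max E c r m = 0"
  | (monomial) b where "b \<in> E" "m = r b" "monomial_max E c r m = c b"
proof -
  have "monomial_max E c r m \<in> insert 0 (c ` {b \<in> E. r b = m})"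
    unfolding monomial_max_def using assms by (intro Max_in) auto
  with that show ?thesis by blast
qed

lemma is_tpoly_monomial_max:
  assumes "finite E"
  shows "is_tpoly (monomial_max E c r)"
proof -
  have "{m. monomial_max E c r m \<noteq> 0} \<subseteq> r ` E"
  proof
    fix m assume "m \<in> {m. monomial_max E c r m \<noteq> 0}"
    then show "m \<in> r ` E" by (cases rule: monomial_max_cases[OF assms, of c r m]) auto
  qed
  then show ?thesis using assms by (auto simp: is_tpoly_def monomial_max_def finite_subset)
qed

lemma tpoly_eval_monomial_max:
  assumes "finite E" "\<forall>i. 0 \<le> x i" "b \<in> E" "0 \<le> c b"
    and max: "\<And>e. e \<in> E \<Longrightarrow> c e * mono_val x (r e) \<le> c b * mono_val x (r b)"
  shows "tpoly_eval (monomial_max E c r) x = c b * mono_val x (r b)"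
proof (rule order_antisym)
  note R = is_tpoly_monomial_max[OF assms(1)]
  have nonneg: "0 \<le> c b * mono_val x (r b)" using assms(2,4) by (simp add: mono_val_nonneg)
  show "tpoly_eval (monomial_max E c r) x \<le> c b * mono_val x (r b)"
  proof (rule tpoly_eval_leI[OF R nonneg])
    fix m
    show "monomial_max E c r m * mono_val x m \<le> c b * mono_val x (r b)"
      by (cases rule: monomial_max_cases[OF assms(1), of c r m]) (use nonneg max in auto)
  qed
  have "c b \<le> monomial_max E c r (r b)"
    unfolding monomial_max_def using assms(1,3) by (intro Max_ge) auto
  then have "c b * mono_val x (r b) \<le> monomial_max E c r (r b) * mono_val x (r b)"
    using assms(2) by (intro mult_right_mono mono_val_nonneg)
  also have "\<dots> \<le> tpoly_eval (monomial_max E c r) x" by (rule tpoly_eval_ge[OF R])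
  finally show "c b * mono_val x (r b) \<le> tpoly_eval (monomial_max E c r) x" .
qed

lemma monomial_quotient_exp:
  assumes "is_tpoly P" "P a \<noteq> 0" "is_tpoly Q" "Q b \<noteq> 0" and exponent: "\<And>i. a i \<le> k * b i"
  shows "Q b ^ k / P a * mono_val (exp_point y) (\<lambda>i. k * b i - a i) =
    exp (real k * log_val Q b y - log_val P a y)"
proof -
  have "weight (\<lambda>i. k * b i - a i) y = real k * weight b y - weight a y"
    by (simp add: weight_def of_nat_diff[OF exponent] left_diff_distrib sum_subtractf
        sum_distrib_left mult.assoc)
  moreover have "Q b ^ k / P a = exp (real k * ln (Q b) - ln (P a))"
    using assms(1-4) by (simp add: is_tpoly_pos exp_diff exp_of_nat_mult)
  ultimately have "Q b ^ k / P a * mono_val (exp_point y) (\<lambda>i. k * b i - a i) =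
      exp ((real k * ln (Q b) - ln (P a)) + (real k * weight b y - weight a y))"
    by (simp only: mono_val_exp exp_add)
  then show ?thesis by (simp add: log_val_def algebra_simps)
qed

definition cell_quotient ::
  "'n::finite tpoly \<Rightarrow> 'n tpoly \<Rightarrow> (('n \<Rightarrow> nat) \<Rightarrow> 'n \<Rightarrow> nat) \<Rightarrow> nat \<Rightarrow> 'n tpoly" where
  "cell_quotient P Q \<alpha> k =
     monomial_max (essential Q) (\<lambda>b. Q b ^ k / P (\<alpha> b)) (\<lambda>b i. k * b i - \<alpha> b i)"

lemma is_tpoly_cell_quotient: "is_tpoly Q \<Longrightarrow> is_tpoly (cell_quotient P Q \<alpha> k)"
  by (simp add: cell_quotient_def is_tpoly_monomial_max finite_essential)

lemma tpoly_eval_cell_quotient: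
  fixes P Q :: "'n::finite tpoly"
  assumes P: "is_tpoly P" and Q: "is_tpoly Q" and cells: "\<forall>b. cell Q b \<subseteq> cell P (\<alpha> b)"
    and dividing: "dividing_power P Q \<alpha> k" and y_cell: "y \<in> cell Q b"
  shows "tpoly_eval (cell_quotient P Q \<alpha> k) (exp_point y) =
    tpoly_eval Q (exp_point y) ^ k / tpoly_eval P (exp_point y)"
proof -
  have b: "b \<in> essential Q" using y_cell by (auto simp: essential_def)
  have quotient: "Q e ^ k / P (\<alpha> e) * mono_val (exp_point y) (\<lambda>i. k * e i - \<alpha> e i) =
      exp (real k * log_val Q e y - log_val P (\<alpha> e) y)" if e: "e \<in> essential Q" for e
  proof (rule monomial_quotient_exp[OF P _ Q essential_nonzero[OF e]])
    from e obtain z where "z \<in> cell P (\<alpha> e)" using cells by (auto simp: essential_def)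
    then show "P (\<alpha> e) \<noteq> 0" by (rule cell_nonzero)
    show "\<alpha> e i \<le> k * e i" for i using dividing e by (simp add: dividing_power_def)
  qed
  have "tpoly_eval (cell_quotient P Q \<alpha> k) (exp_point y) =
      Q b ^ k / P (\<alpha> b) * mono_val (exp_point y) (\<lambda>i. k * b i - \<alpha> b i)"
    unfolding cell_quotient_def
  proof (rule tpoly_eval_monomial_max[OF finite_essential[OF Q] _ b])
    fix e assume e: "e \<in> essential Q"
    have "log_val P (\<alpha> b) y - log_val P (\<alpha> e) y \<le> real k * (log_val Q b y - log_val Q e y)"
      using dividing b e y_cell unfolding dividing_power_def by blast
    then show "Q e ^ k / P (\<alpha> e) * mono_val (exp_point y) (\<lambda>i. k * e i - \<alpha> e i) \<le>
        Q b ^ k / P (\<alpha> b) * mono_val (exp_point y) (\<lambda>i. k * b i - \<alpha> b i)"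
      unfolding quotient[OF e] quotient[OF b] by (simp add: algebra_simps)
  qed (simp_all add: is_tpoly_nonneg P Q)
  also have "\<dots> = exp (log_val Q b y) ^ k / exp (log_val P (\<alpha> b) y)"
    unfolding quotient[OF b] by (simp only: exp_diff exp_of_nat_mult)
  also have "\<dots> = tpoly_eval Q (exp_point y) ^ k / tpoly_eval P (exp_point y)"
    using tpoly_eval_in_cell[OF Q y_cell]
      tpoly_eval_in_cell[OF P subsetD[OF spec[OF cells] y_cell]] by simp
  finally show ?thesis .
qed

lemma dvd_pow_if_tvar_subset:
  fixes P Q :: "'n::finite tpoly"
  assumes P: "is_tpoly P" and Q: "is_tpoly Q" "Q \<noteq> tpoly_zero" and sub: "tvar P \<subseteq> tvar Q"
  shows "\<exists>k\<ge>1. tpoly_dvd P (tpoly_pow Q k)"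
proof -
  obtain \<alpha> where cells: "\<forall>b. cell Q b \<subseteq> cell P (\<alpha> b)"
    using cells_refine_if_tvar_subset[OF P Q(1) sub] by blast
  obtain k where "1 \<le> k" and dividing: "dividing_power P Q \<alpha> k"
    using eventually_happens'[OF sequentially_bot
        eventually_conj[OF eventually_ge_at_top eventually_dividing_power[OF P Q(1) sub cells]]]
    by blast
  define R where "R = cell_quotient P Q \<alpha> k"
  have R: "is_tpoly R" unfolding R_def by (rule is_tpoly_cell_quotient[OF Q(1)])
  have tpolys: "is_tpoly (tpoly_pow Q k)" "is_tpoly (tpoly_mult P R)"
    using P Q R by (simp_all add: is_tpoly_pow is_tpoly_mult)
  have "tpoly_eval (tpoly_pow Q k) (exp_point y) = tpoly_eval (tpoly_mult P R) (exp_point y)"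
    if y_cell: "y \<in> cell Q b" for b y
  proof -
    have nonneg: "\<forall>i. 0 \<le> exp (y i)" by simp
    have "tpoly_eval P (exp_point y) \<noteq> 0"
      using tpoly_eval_in_cell[OF P subsetD[OF spec[OF cells] y_cell]] by simp
    moreover have "tpoly_eval R (exp_point y) =
        tpoly_eval Q (exp_point y) ^ k / tpoly_eval P (exp_point y)"
      unfolding R_def by (rule tpoly_eval_cell_quotient[OF P Q(1) cells dividing y_cell])
    ultimately show ?thesis
      unfolding tpoly_eval_pow[OF Q(1) nonneg] tpoly_eval_mult[OF P R nonneg] by simp
  qed
  then have "tpoly_equiv (tpoly_pow Q k) (tpoly_mult P R)"
    by (rule tpoly_equiv_if_eval_eq[OF tpolys tpoly_eval_eq_if_eq_on_cells[OF Q tpolys]])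
  with \<open>1 \<le> k\<close> R show ?thesis by (auto simp: tpoly_dvd_def)
qed

lemma tpoly_dvd_zero: "tpoly_dvd P (tpoly_zero :: 'n::finite tpoly)"
  unfolding tpoly_dvd_def
  by (intro exI[of _ tpoly_zero]) (simp add: is_tpoly_zero tpoly_mult_zero tpoly_equiv_refl)

theorem theorem3p10:
  fixes P Q :: "('n::finite \<Rightarrow> nat) \<Rightarrow> real"
  assumes "is_tpoly P" and "is_tpoly Q"
  shows "tvar P \<subseteq> tvar Q \<longleftrightarrow> (\<exists>k\<ge>1. tpoly_dvd P (tpoly_pow Q k))"
proof
  assume "\<exists>k\<ge>1. tpoly_dvd P (tpoly_pow Q k)"
  then show "tvar P \<subseteq> tvar Q" using tvar_subset_if_dvd_pow[OF assms] by blast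
next
  assume sub: "tvar P \<subseteq> tvar Q"
  show "\<exists>k\<ge>1. tpoly_dvd P (tpoly_pow Q k)"
  proof (cases "Q = tpoly_zero")
    case True
    then have "tpoly_dvd P (tpoly_pow Q 1)"
      using tpoly_dvd_zero tpoly_pow_one[OF assms(2)] by simp
    then show ?thesis by blast
  next
    case False
    then show ?thesis by (rule dvd_pow_if_tvar_subset[OF assms _ sub])
  qed
qed

end
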